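(* Let $1\leq p<2$ and let $\psi:\mathbb{D}\to\mathbb{D}$ be analytic and univalent. Let $C_\psi(f)=f\circ\psi$. Then: (1) the composition operator $C_\psi: BMOA_p\to BMOA_p$ is bounded, and $$\|C_\psi\|_{BMOA_p\to BMOA_p}\leq C\left(1+\log\frac{1+|\psi(0)|}{1-|\psi(0)|}\right),$$ where $C$ is a constant depending only on $p$; (2) $C_\psi: VMOA_p\to VMOA_p$ is also bounded.
   Context: $\mathbb{D}$ is the open unit disc in $\mathbb{C}$, $H(\mathbb{D})$ the space of analytic functions on $\mathbb{D}$, $dm$ the normalized Lebesgue area measure on $\mathbb{D}$ ($dm=r\,dr\,d\theta/\pi$), and $\varphi_a(z)=\frac{a-z}{1-\bar a z}$ for $a\in\mathbb{D}$. For $p\geq 1$, $BMOA_p$ is the Banach space of $f\in H(\mathbb{D})$ with finite norm $$\|f\|_{BMOA_p}^p=|f(0)|^p+\sup_{a\in\mathbb{D}}\int_{\mathbb{D}}|f'(z)|^p(1-|z|^2)^{p-2}(1-|\varphi_a(z)|^2)\,dm(z).$$ $VMOA_p$ is the closed subspace, with the same norm, of those $f\in BMOA_p$ for which $\lim_{|a|\to1}\int_{\mathbb{D}}|f'(z)|^p(1-|z|^2)^{p-2}(1-|\varphi_a(z)|^2)\,dm(z)=0$. Univalent means injective. *)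

theory Defs
  imports "HOL-Complex_Analysis.Complex_Analysis"
begin

abbreviation unit_disc :: "complex set" where
  "unit_disc \<equiv> ball 0 1"

definition disc_measure :: "complex measure" where
  "disc_measure = scale_measure (ennreal (1 / pi)) (restrict_space lborel unit_disc)"

definition disc_aut :: "complex \<Rightarrow> complex \<Rightarrow> complex" where
  "disc_aut a z = (a - z) / (1 - cnj a * z)"

text \<open>
  The integral is taken in \<^typ>\<open>ennreal\<close>, so that divergence is the value \<open>\<infinity>\<close>.
\<close>

definition bmoa_integral :: "real \<Rightarrow> (complex \<Rightarrow> complex) \<Rightarrow> complex \<Rightarrow> ennreal" where
  "bmoa_integral p f a =
     (\<integral>\<^sup>+ z. ennreal (norm (deriv f z) powr p * (1 - (norm z)\<^sup>2) powr (p - 2)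
                    * (1 - (norm (disc_aut a z))\<^sup>2)) \<partial>disc_measure)"

definition bmoa_sup :: "real \<Rightarrow> (complex \<Rightarrow> complex) \<Rightarrow> ennreal" where
  "bmoa_sup p f = (SUP a \<in> unit_disc. bmoa_integral p f a)"

text \<open>
  Functions on the disc are total functions whose values outside the disc are irrelevant:
  neither membership in the two spaces nor the norm depends on them.
\<close>

definition BMOA :: "real \<Rightarrow> (complex \<Rightarrow> complex) set" where
  "BMOA p = {f. f holomorphic_on unit_disc \<and> bmoa_sup p f < \<infinity>}"

text \<open>Meaningful only on \<^term>\<open>BMOA p\<close>, since \<^const>\<open>enn2real\<close> sends \<open>\<infinity>\<close> to \<open>0\<close>.\<close>

definition bmoa_norm :: "real \<Rightarrow> (complex \<Rightarrow> complex) \<Rightarrow> real" where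
  "bmoa_norm p f = (norm (f 0) powr p + enn2real (bmoa_sup p f)) powr (1 / p)"

text \<open>The filter expresses that \<open>a\<close> lies in the disc and its modulus tends to \<open>1\<close>.\<close>

definition VMOA :: "real \<Rightarrow> (complex \<Rightarrow> complex) set" where
  "VMOA p = {f \<in> BMOA p. (bmoa_integral p f \<longlongrightarrow> 0) (filtercomap norm (at_left 1))}"

definition composition_operator ::
    "(complex \<Rightarrow> complex) \<Rightarrow> (complex \<Rightarrow> complex) \<Rightarrow> complex \<Rightarrow> complex" where
  "composition_operator \<psi> f = f \<circ> \<psi>"

definition bounded_operator ::
    "(complex \<Rightarrow> complex) set \<Rightarrow> (complex \<Rightarrow> complex) set \<Rightarrow> ((complex \<Rightarrow> complex) \<Rightarrow> real)
      \<Rightarrow> ((complex \<Rightarrow> complex) \<Rightarrow> complex \<Rightarrow> complex) \<Rightarrow> bool" where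
  "bounded_operator X Y N T \<longleftrightarrow>
     (\<forall>f\<in>X. T f \<in> Y) \<and>
     (\<forall>f\<in>X. \<forall>g\<in>X. T (\<lambda>z. f z + g z) = (\<lambda>z. T f z + T g z)) \<and>
     (\<forall>c. \<forall>f\<in>X. T (\<lambda>z. c * f z) = (\<lambda>z. c * T f z)) \<and>
     (\<exists>K. \<forall>f\<in>X. N (T f) \<le> K * N f)"

definition operator_norm ::
    "(complex \<Rightarrow> complex) set \<Rightarrow> ((complex \<Rightarrow> complex) \<Rightarrow> real)
      \<Rightarrow> ((complex \<Rightarrow> complex) \<Rightarrow> complex \<Rightarrow> complex) \<Rightarrow> ennreal" where
  "operator_norm X N T = (SUP f \<in> {f \<in> X. N f \<le> 1}. ennreal (N (T f)))"

end

theory Submission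
  imports Defs
begin

text \<open>
  Write \<open>\<phi>\<^sub>a\<close> for \<open>disc_aut a\<close>. The point is the inequality
  \<open>I(f \<circ> \<psi>, a) \<le> C I(f, \<psi> a)\<close> for univalent \<open>\<psi>\<close>, where \<open>I\<close> is \<open>bmoa_integral p\<close>. For \<open>p = 2\<close> it is a
  change of variables and the Schwarz--Pick lemma; for \<open>p < 2\<close> the factor
  \<open>(\<bar>\<psi>'(z)\<bar> (1 - \<bar>z\<bar>\<^sup>2)) powr (p - 2)\<close> left over by the change of variables points the wrong way.

  Instead, \<open>\<bar>f'(\<psi> z)\<bar> powr p\<close> is dominated by a conformally invariant average of
  \<open>\<bar>f'(u)\<bar> powr p\<close>, and exchanging the integrals reduces the claim to a bound for a kernel integral over \<open>z\<close>
  with \<open>u\<close> fixed. With \<open>H = \<phi>\<^sub>u \<circ> \<psi>\<close> and \<open>c = 1 - \<bar>H a\<bar>\<^sup>2\<close>, Young's inequality bounds that kernel by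
  \<open>c \<bar>H'\<bar>\<^sup>2\<close>, whose integral is at most \<open>c\<close> because \<open>H\<close> is univalent, and
  \<open>(1 - \<bar>H\<bar>\<^sup>2)\<^sup>4 \<bar>\<phi>\<^sub>a'\<bar>\<^sup>2 / c\<close>. The integral of the latter is controlled by a Hardy inequality along the radii:
  for \<open>a = 0\<close> and \<open>Q = (1 - \<bar>H\<bar>\<^sup>2)\<^sup>4\<close>, the integral of \<open>Q\<close> is at most \<open>O(c\<^sup>4)\<close> plus that of
  \<open>4 (1 - \<bar>z\<bar>) \<bar>\<nabla>Q\<bar>\<close>, which by Schwarz--Pick and AM--GM is at most
  \<open>Q / 2 + O(c\<^sup>2) \<bar>H'\<bar>\<^sup>2\<close>, so it is absorbed.

  For \<open>VMOA\<close> and \<open>\<bar>a\<bar> \<rightarrow> 1\<close>: if \<open>\<bar>\<psi> a\<bar>\<close> is close to \<open>1\<close>, the inequality suffices. Otherwise the average over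
  \<open>u\<close> near the circle is small uniformly in \<open>a\<close>, and on compact sets of \<open>u\<close> the kernel integral is
  \<open>O(I(\<psi>, a))\<close>, which tends to \<open>0\<close> since \<open>\<psi>\<close> has finite Dirichlet integral.
\<close>

section \<open>Univalent change of variables\<close>

text \<open>The Jacobian formula for Lebesgue measure involves a determinant on
  \<open>real^2\<close>, so complex maps are conjugated by this identification and its
  inverse.\<close>

definition vec2_to_complex :: "real^2 \<Rightarrow> complex" where
  "vec2_to_complex x = Complex (x$1) (x$2)"

definition complex_to_vec2 :: "complex \<Rightarrow> real^2" where
  "complex_to_vec2 z = vector [Re z, Im z]"

lemma vec2_to_complex_inverse [simp]: "complex_to_vec2 (vec2_to_complex x) = x"
  by (simp add: vec2_to_complex_def complex_to_vec2_def vec_eq_iff forall_2)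

lemma complex_to_vec2_inverse [simp]: "vec2_to_complex (complex_to_vec2 z) = z"
  by (simp add: vec2_to_complex_def complex_to_vec2_def)

lemma linear_vec2_to_complex: "linear vec2_to_complex"
  by (rule linearI) (simp_all add: vec2_to_complex_def complex_eq_iff)

lemma linear_complex_to_vec2: "linear complex_to_vec2"
  by (rule linearI) (simp_all add: complex_to_vec2_def vec_eq_iff forall_2)

lemma continuous_on_vec2_to_complex: "continuous_on S vec2_to_complex"
  using linear_vec2_to_complex by (simp add: linear_continuous_on linear_conv_bounded_linear)

lemma measurable_vec2_to_complex [measurable]: "vec2_to_complex \<in> borel \<rightarrow>\<^sub>M borel"
  by (rule borel_measurable_continuous_onI) (rule continuous_on_vec2_to_complex)

lemma Basis_vec2: "(Basis :: (real^2) set) = {axis 1 1, axis 2 1}"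
  by (auto simp: Basis_vec_def UNIV_2)

text \<open>Lebesgue measure is determined by its values on boxes, and the identification carries
  boxes to boxes with the same side lengths.\<close>

lemma lborel_complex_eq_distr: "(lborel :: complex measure) = distr lborel borel vec2_to_complex"
proof (rule lborel_eqI)
  fix l u :: complex
  assume lu: "\<And>b. b \<in> Basis \<Longrightarrow> l \<bullet> b \<le> u \<bullet> b"
  have "axis 1 1 \<noteq> (axis 2 1 :: real^2)"
    by (simp add: axis_eq_axis)
  moreover have "vec2_to_complex -` box l u = box (complex_to_vec2 l) (complex_to_vec2 u)"
    by (auto simp: box_def Basis_complex_def Basis_vec2 vec2_to_complex_def complex_to_vec2_def
        inner_axis)
  moreover have "Re l \<le> Re u" "Im l \<le> Im u"
    using lu[of 1] lu[of \<i>] by (auto simp: Basis_complex_def)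
  ultimately show "emeasure (distr lborel borel vec2_to_complex) (box l u)
      = (\<Prod>b\<in>Basis. (u - l) \<bullet> b)"
    by (simp add: emeasure_distr emeasure_lborel_box_eq Basis_vec2 Basis_complex_def
        inner_axis complex_to_vec2_def)
qed simp

text \<open>The Cauchy-Riemann equations in matrix form: multiplication by x + iy has rows (x, -y)
  and (y, x), with determinant x^2 + y^2. Hence the real Jacobian of a holomorphic map is the
  squared modulus of its derivative.\<close>

lemma det_matrix_complex_mult:
  "det (matrix (complex_to_vec2 \<circ> (*) c \<circ> vec2_to_complex)) = (norm c)\<^sup>2"
  unfolding cmod_power2
  by (simp add: det_2 matrix_def complex_to_vec2_def vec2_to_complex_def axis_def power2_eq_square)

text \<open>Area formula for injective holomorphic maps: transport to \<open>real^2\<close>, where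
  the derivative is a complex multiplication, apply the real change of variables, and transport
  back.\<close>

lemma nn_integral_deriv_eq_measure_image:
  fixes g :: "complex \<Rightarrow> complex"
  assumes hol: "g holomorphic_on U" and U: "open U" and inj: "inj_on g U"
    and E: "E \<in> sets borel" "E \<subseteq> U" and gE: "g ` E \<in> sets borel" "bounded (g ` E)"
  shows "(\<integral>\<^sup>+z. ennreal ((norm (deriv g z))\<^sup>2) * indicator E z \<partial>lborel) = emeasure lborel (g ` E)"
proof -
  define G where "G = complex_to_vec2 \<circ> g \<circ> vec2_to_complex"
  define S where "S = vec2_to_complex -` E"
  define J where "J = (\<lambda>x. (norm (deriv g (vec2_to_complex x)))\<^sup>2)"
  have S: "S \<in> sets borel"
    unfolding S_def using E measurable_sets_borel[OF measurable_vec2_to_complex] by blast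
  have der: "(G has_derivative (complex_to_vec2 \<circ> (*) (deriv g (vec2_to_complex x)) \<circ> vec2_to_complex))
     (at x within S)" if "x \<in> S" for x
  proof -
    have "(g has_field_derivative deriv g (vec2_to_complex x)) (at (vec2_to_complex x))"
      using that E hol U by (auto simp: S_def intro: holomorphic_derivI)
    then have g: "(g has_derivative (*) (deriv g (vec2_to_complex x))) (at (vec2_to_complex x))"
      by (simp add: has_field_derivative_def)
    have 1: "(vec2_to_complex has_derivative vec2_to_complex) (at x)"
      and 2: "(complex_to_vec2 has_derivative complex_to_vec2) (at y)" for y
      using linear_vec2_to_complex linear_complex_to_vec2
      by (auto intro: linear_imp_has_derivative)
    have "(G has_derivative (complex_to_vec2 \<circ> (*) (deriv g (vec2_to_complex x)) \<circ> vec2_to_complex)) (at x)"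
      unfolding G_def
      by (intro diff_chain_at 1 2) (simp add: g)
    then show ?thesis
      by (rule has_derivative_at_withinI)
  qed
  have injG: "inj_on G S"
    unfolding G_def
  proof (rule inj_onI)
    fix x y assume "x \<in> S" "y \<in> S"
      "(complex_to_vec2 \<circ> g \<circ> vec2_to_complex) x = (complex_to_vec2 \<circ> g \<circ> vec2_to_complex) y"
    then have "g (vec2_to_complex x) = g (vec2_to_complex y)"
      by (metis comp_apply complex_to_vec2_inverse)
    with \<open>x \<in> S\<close> \<open>y \<in> S\<close> have "vec2_to_complex x = vec2_to_complex y"
      using inj E by (auto simp: S_def inj_on_def)
    then show "x = y"
      by (metis vec2_to_complex_inverse)
  qed
  have img: "G ` S = vec2_to_complex -` (g ` E)"
  proof -
    have "vec2_to_complex -` E = complex_to_vec2 ` E"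
      by (auto simp: image_iff) (metis vec2_to_complex_inverse)
    moreover have "vec2_to_complex -` (g ` E) = complex_to_vec2 ` (g ` E)"
      by (auto simp: image_iff) (metis vec2_to_complex_inverse)
    ultimately show ?thesis
      by (simp add: S_def G_def image_comp comp_def)
  qed
  have GS: "G ` S \<in> sets borel"
    unfolding img using gE measurable_sets_borel[OF measurable_vec2_to_complex] by blast
  \<comment> \<open>Boundedness makes the measure of the image finite, so the area formula can be
    applied with a real value \<open>m\<close> and passed to \<open>ennreal\<close>
    afterwards.\<close>
  have "bounded (G ` S)"
    using gE(2) bounded_linear_image[OF gE(2), of complex_to_vec2] linear_complex_to_vec2
    unfolding G_def S_def
    by (auto simp: linear_conv_bounded_linear image_comp comp_def intro: bounded_subset)
  then have lm: "G ` S \<in> lmeasurable"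
    using GS by (intro bounded_set_imp_lmeasurable) auto
  define m where "m = measure lebesgue (G ` S)"
  have hi: "(J has_integral m) S"
    using has_measure_differentiable_image[of S G "\<lambda>x. complex_to_vec2 \<circ> (*) (deriv g (vec2_to_complex x)) \<circ> vec2_to_complex" m]
      S der injG lm unfolding det_matrix_complex_mult m_def J_def by auto
  have contd: "continuous_on U (deriv g)"
    using hol U holomorphic_deriv holomorphic_on_imp_continuous_on by blast
  have mE: "(\<lambda>z. ennreal ((norm (deriv g z))\<^sup>2) * indicator E z) \<in> borel_measurable borel"
  proof -
    have "(\<lambda>z. indicat_real E z *\<^sub>R (norm (deriv g z))\<^sup>2) \<in> borel_measurable borel"
      by (rule borel_measurable_continuous_on_indicator[OF E(1)])
        (intro continuous_intros continuous_on_subset[OF contd] E(2))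
    then have "(\<lambda>z. ennreal (indicat_real E z *\<^sub>R (norm (deriv g z))\<^sup>2)) \<in> borel_measurable borel"
      by measurable
    also have "(\<lambda>z. ennreal (indicat_real E z *\<^sub>R (norm (deriv g z))\<^sup>2))
       = (\<lambda>z. ennreal ((norm (deriv g z))\<^sup>2) * indicator E z)"
      by (auto simp: indicator_def)
    finally show ?thesis .
  qed
  have eq: "ennreal (J x) * indicator S x
     = ennreal ((norm (deriv g (vec2_to_complex x)))\<^sup>2) * indicator E (vec2_to_complex x)" for x
    by (auto simp: J_def S_def indicator_def)
  have "(\<integral>\<^sup>+z. ennreal ((norm (deriv g z))\<^sup>2) * indicator E z \<partial>lborel)
      = (\<integral>\<^sup>+x. ennreal (J x) * indicator S x \<partial>lborel)"
    unfolding eq using mE by (subst lborel_complex_eq_distr) (simp add: nn_integral_distr)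
  also have "\<dots> = ennreal m"
  proof -
    have "(\<integral>\<^sup>+x. ennreal (indicator S x * J x) \<partial>lborel) = ennreal m"
      by (rule nn_integral_has_integral_lebesgue[OF _ hi]) (simp add: J_def)
    moreover have "ennreal (indicator S x * J x) = ennreal (J x) * indicator S x" for x
      by (simp add: indicator_def)
    ultimately show ?thesis by simp
  qed
  also have "\<dots> = emeasure lborel (G ` S)"
  proof -
    have "ennreal m = emeasure lebesgue (G ` S)"
      unfolding m_def using lm by (rule emeasure_eq_measure2[symmetric])
    then show ?thesis
      using GS by simp
  qed
  also have "\<dots> = emeasure lborel (g ` E)"
    unfolding img using gE by (subst lborel_complex_eq_distr) (simp add: emeasure_distr)
  finally show ?thesis .
qed


section \<open>The normalized area measure and substitution by univalent self-maps of the
  disc\<close>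

lemma space_disc_measure [simp]: "space disc_measure = unit_disc"
  by (simp add: disc_measure_def space_restrict_space space_scale_measure)

lemma sets_disc_measure: "sets disc_measure = sets (restrict_space borel unit_disc)"
  by (simp add: disc_measure_def sets_restrict_space)

lemma measurable_disc_measure_id [measurable]: "(\<lambda>z. z) \<in> disc_measure \<rightarrow>\<^sub>M borel"
proof -
  have "(\<lambda>z. z) \<in> restrict_space borel unit_disc \<rightarrow>\<^sub>M borel"
    by (rule measurable_restrict_space1) simp
  then show ?thesis
    by (simp add: measurable_cong_sets[OF sets_disc_measure refl])
qed

lemma nn_integral_disc_measure:
  assumes "F \<in> borel_measurable disc_measure"
  shows "nn_integral disc_measure F = ennreal (1 / pi) * (\<integral>\<^sup>+z. F z * indicator unit_disc z \<partial>lborel)"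
proof -
  have "F \<in> borel_measurable (restrict_space lborel unit_disc)"
    using assms by (simp add: disc_measure_def cong: measurable_cong_sets)
  then show ?thesis
    unfolding disc_measure_def by (simp add: nn_integral_scale_measure nn_integral_restrict_space)
qed

lemma emeasure_disc_measure:
  assumes "A \<in> sets disc_measure"
  shows "emeasure disc_measure A = ennreal (1 / pi) * emeasure lborel A"
proof -
  have "A \<subseteq> unit_disc"
    using assms by (metis sets.sets_into_space space_disc_measure)
  then show ?thesis
    by (simp add: disc_measure_def emeasure_restrict_space)
qed

lemma emeasure_disc_measure_disc [simp]: "emeasure disc_measure unit_disc = 1"
proof -
  have "unit_disc \<in> sets disc_measure"
    by (metis sets.top space_disc_measure)
  then show ?thesis
    by (simp add: emeasure_disc_measure emeasure_ball unit_ball_vol_2 flip: ennreal_mult)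
qed

lemma finite_measure_disc_measure: "finite_measure disc_measure"
  by (rule finite_measureI) simp

lemma continuous_on_disc_measurable:
  fixes F :: "complex \<Rightarrow> 'b::topological_space"
  assumes "continuous_on unit_disc F"
  shows "F \<in> disc_measure \<rightarrow>\<^sub>M borel"
  using borel_measurable_continuous_on_restrict[OF assms]
  by (simp add: measurable_cong_sets[OF sets_disc_measure refl])

text \<open>Provides joint measurability for exchanging integrals: the integrands below are
  continuous only on a product of subsets, not on the whole space.\<close>

lemma borel_measurable_pair_continuous_on:
  fixes F :: "'a::second_countable_topology \<times> 'b::second_countable_topology \<Rightarrow> 'c::topological_space"
  assumes M: "sets M = sets (restrict_space borel A)" and N: "sets N = sets (restrict_space borel B)"
    and F: "continuous_on (A \<times> B) F"
  shows "F \<in> M \<Otimes>\<^sub>M N \<rightarrow>\<^sub>M borel"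
proof -
  have sp: "space M = A" "space N = B"
    using sets_eq_imp_space_eq[OF M] sets_eq_imp_space_eq[OF N] by (auto simp: space_restrict_space)
  have [measurable]: "(\<lambda>x. x) \<in> M \<rightarrow>\<^sub>M borel" "(\<lambda>x. x) \<in> N \<rightarrow>\<^sub>M borel"
    unfolding measurable_cong_sets[OF M refl] measurable_cong_sets[OF N refl]
    by (auto intro: measurable_restrict_space1)
  have "(\<lambda>z. (fst z, snd z)) \<in> M \<Otimes>\<^sub>M N \<rightarrow>\<^sub>M borel \<Otimes>\<^sub>M borel"
    by measurable
  then have "(\<lambda>z. z) \<in> M \<Otimes>\<^sub>M N \<rightarrow>\<^sub>M restrict_space borel (A \<times> B)"
    by (intro measurable_restrict_space2) (auto simp: space_pair_measure borel_prod sp)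
  from measurable_compose[OF this borel_measurable_continuous_on_restrict[OF F]]
  show ?thesis .
qed

text \<open>By the area formula the push-forward of |g'|^2 dm under \<open>g\<close> gives a set
  \<open>A\<close> the area of the part of \<open>A\<close> inside the image of \<open>g\<close>.
  This measure is dominated by dm, and the integral is monotone in the measure. It is an inequality
  because \<open>g\<close> may fail to be onto.\<close>

lemma nn_integral_univalent_le:
  fixes g :: "complex \<Rightarrow> complex"
  assumes hol: "g holomorphic_on unit_disc" and inj: "inj_on g unit_disc"
    and sub: "g ` unit_disc \<subseteq> unit_disc"
    and F: "F \<in> borel_measurable disc_measure"
  shows "(\<integral>\<^sup>+z. F (g z) * ennreal ((norm (deriv g z))\<^sup>2) \<partial>disc_measure) \<le> (\<integral>\<^sup>+z. F z \<partial>disc_measure)"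
proof -
  let ?J = "\<lambda>z. ennreal ((norm (deriv g z))\<^sup>2)"
  have "continuous_on unit_disc (deriv g)"
    using hol holomorphic_deriv holomorphic_on_imp_continuous_on by blast
  then have J: "?J \<in> borel_measurable disc_measure"
    by (intro measurable_compose[OF _ measurable_ennreal] continuous_on_disc_measurable continuous_intros)
  have gm: "g \<in> disc_measure \<rightarrow>\<^sub>M borel"
    using hol holomorphic_on_imp_continuous_on continuous_on_disc_measurable by blast
  then have g: "g \<in> disc_measure \<rightarrow>\<^sub>M disc_measure"
    using sub measurable_restrict_space2[of g disc_measure unit_disc borel]
    by (auto simp: measurable_cong_sets[OF refl sets_disc_measure])
  define N where "N = distr (density disc_measure ?J) disc_measure g"
  have le: "N \<le> disc_measure"
  proof (subst le_measure)
    show "\<forall>A\<in>sets N. emeasure N A \<le> emeasure disc_measure A"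
    proof
      fix A assume "A \<in> sets N"
      then have A: "A \<in> sets disc_measure"
        by (simp add: N_def)
      then have Ab: "A \<in> sets borel" "A \<subseteq> unit_disc"
        by (auto simp: sets_disc_measure sets_restrict_space)
      define E where "E = g -` A \<inter> unit_disc"
      have E: "E \<in> sets disc_measure"
        unfolding E_def using measurable_sets[OF g A] by simp
      then have Eb: "E \<in> sets borel"
        by (auto simp: sets_disc_measure sets_restrict_space)
      \<comment> \<open>The open mapping theorem keeps the image of \<open>E\<close> Borel: it is
        the intersection of \<open>A\<close> with an open set.\<close>
      have "open (g ` unit_disc)"
        using hol inj by (intro open_mapping_thm3) auto
      moreover have gE: "g ` E = A \<inter> g ` unit_disc"
        by (auto simp: E_def)
      ultimately have gEb: "g ` E \<in> sets borel"
        using Ab by auto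
      have "bounded (g ` E)"
        using sub bounded_subset[OF bounded_ball] gE by blast
      then have area: "(\<integral>\<^sup>+z. ?J z * indicator E z \<partial>lborel) = emeasure lborel (g ` E)"
        using hol inj Eb gEb by (intro nn_integral_deriv_eq_measure_image[where U=unit_disc])
          (auto simp: E_def)
      have "emeasure N A = (\<integral>\<^sup>+z. ?J z * indicator E z \<partial>disc_measure)"
        unfolding N_def using g J A E by (simp add: emeasure_distr emeasure_density E_def)
      also have "\<dots> = ennreal (1 / pi) * (\<integral>\<^sup>+z. ?J z * indicator E z \<partial>lborel)"
      proof -
        have "(\<lambda>z. ?J z * indicator E z) \<in> borel_measurable disc_measure"
          using J E by measurable
        moreover have "?J z * indicator E z * indicator unit_disc z = ?J z * indicator E z" for z
          by (auto simp: E_def indicator_def)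
        ultimately show ?thesis
          by (simp add: nn_integral_disc_measure)
      qed
      also have "\<dots> \<le> ennreal (1 / pi) * emeasure lborel A"
        unfolding area gE using Ab by (intro mult_left_mono emeasure_mono) auto
      finally show "emeasure N A \<le> emeasure disc_measure A"
        using A by (simp add: emeasure_disc_measure)
    qed
  qed (simp add: N_def)
  have "(\<integral>\<^sup>+z. F (g z) * ?J z \<partial>disc_measure) = nn_integral N F"
    unfolding N_def using J F g
    by (subst nn_integral_distr) (auto simp: nn_integral_density mult.commute)
  also have "\<dots> \<le> nn_integral disc_measure F"
    by (rule nn_integral_mono_measure[OF _ le]) (simp add: N_def)
  finally show ?thesis .
qed

section \<open>Disc automorphisms and the Schwarz--Pick lemma\<close>

lemma disc_aut_denom_nonzero:
  assumes "norm a < 1" "norm z < 1"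
  shows "1 - cnj a * z \<noteq> 0"
proof
  assume "1 - cnj a * z = 0"
  then have "norm (cnj a * z) = 1" by (metis eq_iff_diff_eq_0 norm_one)
  moreover have "norm (cnj a * z) < 1"
    using norm_mult_less[of "cnj a" 1 z 1] assms by simp
  ultimately show False by simp
qed

lemma norm_disc_aut_denom_ge: "norm a \<le> 1 \<Longrightarrow> norm (1 - cnj a * z) \<ge> 1 - norm z"
  using norm_triangle_ineq2[of 1 "cnj a * z"] mult_left_le_one_le[of "norm z" "norm a"]
  by (simp add: norm_mult)

lemma one_minus_norm_disc_aut_sq:
  assumes "norm a < 1" "norm z < 1"
  shows "1 - (norm (disc_aut a z))\<^sup>2 = (1 - (norm a)\<^sup>2) * (1 - (norm z)\<^sup>2) / (norm (1 - cnj a * z))\<^sup>2"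
proof -
  have *: "(norm (1 - cnj a * z))\<^sup>2 - (norm (a - z))\<^sup>2 = (1 - (norm a)\<^sup>2) * (1 - (norm z)\<^sup>2)"
    unfolding cmod_power2 by (simp add: power2_eq_square algebra_simps)
  have "norm (1 - cnj a * z) \<noteq> 0"
    using disc_aut_denom_nonzero[OF assms] by simp
  then show ?thesis
    unfolding *[symmetric] disc_aut_def norm_divide power_divide by (simp add: field_simps)
qed

lemma norm_sq_less_one: "norm z < 1 \<Longrightarrow> (norm z)\<^sup>2 < 1"
  by (simp add: power_less_one_iff abs_square_less_1)

lemma norm_disc_aut_less_one:
  assumes "norm a < 1" "norm z < 1"
  shows "norm (disc_aut a z) < 1"
proof -
  have "0 < 1 - (norm (disc_aut a z))\<^sup>2"
    unfolding one_minus_norm_disc_aut_sq[OF assms]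
    using assms disc_aut_denom_nonzero[OF assms] norm_sq_less_one
    by (intro divide_pos_pos mult_pos_pos) auto
  then show ?thesis
    by (simp add: abs_square_less_1)
qed

lemma disc_aut_disc_aut:
  assumes "norm a < 1" "norm z < 1"
  shows "disc_aut a (disc_aut a z) = z"
proof -
  have 1: "1 - cnj a * z \<noteq> 0" and 2: "1 - cnj a * a \<noteq> 0"
    using disc_aut_denom_nonzero assms by auto
  have "a - (a - z) / (1 - cnj a * z) = (1 - cnj a * a) * z / (1 - cnj a * z)"
    "1 - cnj a * ((a - z) / (1 - cnj a * z)) = (1 - cnj a * a) / (1 - cnj a * z)"
    using 1 by (simp_all add: field_simps)
  then show ?thesis
    using 1 2 by (simp add: disc_aut_def)
qed

lemma inj_on_disc_aut: "norm a < 1 \<Longrightarrow> inj_on (disc_aut a) unit_disc"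
  by (metis disc_aut_disc_aut inj_onI mem_ball_0)

lemma disc_aut_image: "norm a < 1 \<Longrightarrow> disc_aut a ` unit_disc \<subseteq> unit_disc"
  using norm_disc_aut_less_one by auto

lemma holomorphic_on_disc_aut: "norm a < 1 \<Longrightarrow> disc_aut a holomorphic_on unit_disc"
  unfolding disc_aut_def using disc_aut_denom_nonzero by (auto intro!: holomorphic_intros)

lemma norm_disc_aut_commute: "norm (disc_aut a z) = norm (disc_aut z a)"
proof -
  have "norm (1 - cnj a * z) = norm (1 - cnj z * a)"
    by (metis complex_cnj_cnj complex_cnj_diff complex_cnj_mult complex_cnj_one complex_mod_cnj mult.commute)
  then show ?thesis
    by (simp add: disc_aut_def norm_divide norm_minus_commute)
qed

lemma disc_aut_zero_left: "disc_aut 0 z = - z"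
  by (simp add: disc_aut_def)

lemma disc_aut_zero_right: "disc_aut a 0 = a"
  by (simp add: disc_aut_def)

lemma disc_aut_self: "disc_aut a a = 0"
  by (simp add: disc_aut_def)

lemma norm_deriv_disc_aut_eq:
  assumes "norm a < 1" "norm z < 1"
  shows "norm (deriv (disc_aut a) z) = (1 - (norm a)\<^sup>2) / (norm (1 - cnj a * z))\<^sup>2"
proof -
  have nz: "1 - cnj a * z \<noteq> 0"
    by (rule disc_aut_denom_nonzero[OF assms])
  have "(disc_aut a has_field_derivative
     ((-1) * (1 - cnj a * z) - (a - z) * (- cnj a)) / ((1 - cnj a * z) * (1 - cnj a * z))) (at z)"
    unfolding disc_aut_def using nz by (auto intro!: derivative_eq_intros)
  then have "deriv (disc_aut a) z = (cnj a * a - 1) / (1 - cnj a * z)\<^sup>2"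
    by (simp add: DERIV_imp_deriv algebra_simps power2_eq_square)
  moreover have "norm (cnj a * a - 1) = 1 - (norm a)\<^sup>2"
  proof -
    have "cnj a * a - 1 = of_real ((norm a)\<^sup>2 - 1)"
      by (simp add: complex_norm_square[symmetric] mult.commute)
    then have "norm (cnj a * a - 1) = \<bar>(norm a)\<^sup>2 - 1\<bar>"
      by (metis norm_of_real)
    then show ?thesis
      using norm_sq_less_one[OF assms(1)] by simp
  qed
  ultimately show ?thesis
    by (simp add: norm_divide norm_power)
qed

text \<open>Disc automorphisms are isometries of the hyperbolic metric |dz| / (1 - |z|^2).\<close>

lemma norm_deriv_disc_aut:
  assumes "norm a < 1" "norm z < 1"
  shows "norm (deriv (disc_aut a) z) * (1 - (norm z)\<^sup>2) = 1 - (norm (disc_aut a z))\<^sup>2"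
  by (simp add: norm_deriv_disc_aut_eq one_minus_norm_disc_aut_sq assms)

text \<open>The denominator in the formula for 1 - |\<phi>_a(z)|^2 is at least (1 - |z|)^2, and 1 -
  |z|^2 is at most 2 (1 - |z|); squaring gives the factor 4.\<close>

lemma one_minus_norm_disc_aut_sq_le:
  assumes "norm a < 1" "norm z < 1"
  shows "1 - (norm (disc_aut a z))\<^sup>2 \<le> 4 * (1 - (norm a)\<^sup>2) / (1 - (norm z)\<^sup>2)"
proof -
  define x y where "x = 1 - norm z" and "y = 1 - (norm z)\<^sup>2"
  have z: "0 < x" "0 < y"
    using assms norm_sq_less_one by (auto simp: x_def y_def)
  have "y \<le> 2 * x"
    unfolding x_def y_def using zero_le_power2[of "1 - norm z"] by (simp add: power2_eq_square algebra_simps)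
  then have "y\<^sup>2 \<le> (2 * x)\<^sup>2"
    using z by (intro power_mono) auto
  also have "(2 * x)\<^sup>2 \<le> 4 * (norm (1 - cnj a * z))\<^sup>2"
    using norm_disc_aut_denom_ge[of a z] z assms power_mono[of x "norm (1 - cnj a * z)" 2]
    by (simp only: x_def power_mult_distrib) simp
  finally have "y\<^sup>2 \<le> 4 * (norm (1 - cnj a * z))\<^sup>2" .
  then have "y / (norm (1 - cnj a * z))\<^sup>2 \<le> 4 / y"
    using z disc_aut_denom_nonzero[OF assms] by (simp add: field_simps power2_eq_square)
  then have "(1 - (norm a)\<^sup>2) * (y / (norm (1 - cnj a * z))\<^sup>2) \<le> (1 - (norm a)\<^sup>2) * (4 / y)"
    using norm_sq_less_one[OF assms(1)] by (intro mult_left_mono) auto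
  then show ?thesis
    by (simp add: one_minus_norm_disc_aut_sq[OF assms] y_def mult.commute)
qed

text \<open>Conjugation by the automorphisms that exchange \<open>a\<close> and \<open>H a\<close>
  with 0 reduces this to the Schwarz lemma.\<close>

lemma Schwarz_Pick:
  assumes hol: "H holomorphic_on unit_disc" and sub: "H ` unit_disc \<subseteq> unit_disc"
    and a: "norm a < 1" and z: "norm z < 1"
  shows "norm (disc_aut (H a) (H z)) \<le> norm (disc_aut a z)"
proof -
  have Ha: "norm (H a) < 1"
    using sub a by (simp add: image_subset_iff)
  define F where "F = disc_aut (H a) \<circ> H \<circ> disc_aut a"
  have "F holomorphic_on unit_disc"
    unfolding F_def
    by (rule holomorphic_on_compose_gen[OF holomorphic_on_disc_aut[OF a]
          holomorphic_on_compose_gen[OF hol holomorphic_on_disc_aut[OF Ha] sub] disc_aut_image[OF a], unfolded comp_assoc[symmetric]])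
  moreover have "F 0 = 0"
    by (simp add: F_def disc_aut_zero_right disc_aut_self)
  moreover have "norm (F w) < 1" if "norm w < 1" for w
    using that a Ha sub by (auto simp: F_def image_subset_iff norm_disc_aut_less_one)
  ultimately have "norm (F (disc_aut a z)) \<le> norm (disc_aut a z)"
    using norm_disc_aut_less_one[OF a z] by (rule Schwarz_Lemma(1))
  then show ?thesis
    by (simp add: F_def disc_aut_disc_aut a z)
qed

text \<open>Schwarz-Pick replaces \<open>disc_aut a z\<close> by
  \<open>disc_aut (H a) (H z)\<close>, to which the bound
  \<open>one_minus_norm_disc_aut_sq_le\<close> applies. This is how quantities at \<open>z\<close>
  are traded for the value of \<open>H\<close> at the base point \<open>a\<close>.\<close>

lemma one_minus_norm_sq_mult_le:
  assumes hol: "H holomorphic_on unit_disc" and sub: "H ` unit_disc \<subseteq> unit_disc"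
    and z: "norm z < 1" and a: "norm a < 1"
  shows "(1 - (norm (disc_aut a z))\<^sup>2) * (1 - (norm (H z))\<^sup>2) \<le> 4 * (1 - (norm (H a))\<^sup>2)"
proof -
  have H: "norm (H a) < 1" "norm (H z) < 1"
    using sub z a by (simp_all add: image_subset_iff)
  have "(norm (disc_aut (H a) (H z)))\<^sup>2 \<le> (norm (disc_aut a z))\<^sup>2"
    using Schwarz_Pick[OF hol sub a z] by (intro power_mono) auto
  then have "1 - (norm (disc_aut a z))\<^sup>2 \<le> 4 * (1 - (norm (H a))\<^sup>2) / (1 - (norm (H z))\<^sup>2)"
    using one_minus_norm_disc_aut_sq_le[OF H] by linarith
  then show ?thesis
    using norm_sq_less_one[OF H(2)] by (simp add: field_simps)
qed

text \<open>A Harnack-type bound. \<open>H z\<close> is the image under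
  \<open>disc_aut (H 0)\<close> of a point \<open>v\<close> with |v| at most 1/2 by Schwarz-Pick, so
  the denominator in the formula for 1 - |\<phi>_a|^2 is at least (1/2)^2.\<close>

lemma one_minus_norm_sq_le_near_zero:
  assumes hol: "H holomorphic_on unit_disc" and sub: "H ` unit_disc \<subseteq> unit_disc"
    and z: "norm z \<le> 1/2"
  shows "1 - (norm (H z))\<^sup>2 \<le> 4 * (1 - (norm (H 0))\<^sup>2)"
proof -
  have H: "norm (H 0) < 1" "norm (H z) < 1"
    using sub z by (simp_all add: image_subset_iff)
  define v where "v = disc_aut (H 0) (H z)"
  have v: "norm v \<le> 1/2" "norm v < 1"
    using Schwarz_Pick[OF hol sub, of 0 z] z by (auto simp: v_def disc_aut_zero_left)
  have "1 / 2 \<le> norm (1 - cnj (H 0) * v)"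
    using norm_disc_aut_denom_ge[of "H 0" v] v H by simp
  then have "(1 / 2)\<^sup>2 \<le> (norm (1 - cnj (H 0) * v))\<^sup>2"
    by (intro power_mono) auto
  then have d: "1 \<le> 4 * (norm (1 - cnj (H 0) * v))\<^sup>2"
    by (simp add: power2_eq_square)
  have c: "0 < 1 - (norm (H 0))\<^sup>2"
    using norm_sq_less_one[OF H(1)] by simp
  have "1 - (norm (H z))\<^sup>2 = 1 - (norm (disc_aut (H 0) v))\<^sup>2"
    by (simp add: v_def disc_aut_disc_aut H)
  also have "\<dots> = (1 - (norm (H 0))\<^sup>2) * (1 - (norm v)\<^sup>2) / (norm (1 - cnj (H 0) * v))\<^sup>2"
    using H v by (intro one_minus_norm_disc_aut_sq) auto
  also have "\<dots> \<le> (1 - (norm (H 0))\<^sup>2) * 1 / (norm (1 - cnj (H 0) * v))\<^sup>2"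
    using c by (intro divide_right_mono mult_left_mono) auto
  also have "\<dots> \<le> 4 * (1 - (norm (H 0))\<^sup>2)"
    using mult_left_mono[OF d, of "1 - (norm (H 0))\<^sup>2"] c d
    by (subst pos_divide_le_eq) (auto simp: algebra_simps)
  finally show ?thesis .
qed

section \<open>Composition of self-maps of the disc with automorphisms\<close>

lemma univalent_disc_aut_comp:
  assumes hol: "\<psi> holomorphic_on unit_disc" and sub: "\<psi> ` unit_disc \<subseteq> unit_disc"
    and inj: "inj_on \<psi> unit_disc" and u: "norm u < 1"
  shows "(disc_aut u \<circ> \<psi>) holomorphic_on unit_disc" "(disc_aut u \<circ> \<psi>) ` unit_disc \<subseteq> unit_disc"
    "inj_on (disc_aut u \<circ> \<psi>) unit_disc"
proof -
  show "(disc_aut u \<circ> \<psi>) holomorphic_on unit_disc"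
    using holomorphic_on_compose_gen[OF hol holomorphic_on_disc_aut[OF u] sub] .
  show "(disc_aut u \<circ> \<psi>) ` unit_disc \<subseteq> unit_disc"
    using sub disc_aut_image[OF u] by auto
  show "inj_on (disc_aut u \<circ> \<psi>) unit_disc"
    using inj inj_on_subset[OF inj_on_disc_aut[OF u] sub] by (rule comp_inj_on)
qed

lemma norm_deriv_comp_disc:
  assumes "f holomorphic_on unit_disc" "\<psi> holomorphic_on unit_disc" "\<psi> ` unit_disc \<subseteq> unit_disc" "norm z < 1"
  shows "norm (deriv (f \<circ> \<psi>) z) = norm (deriv f (\<psi> z)) * norm (deriv \<psi> z)"
proof -
  have "deriv (f \<circ> \<psi>) z = deriv f (\<psi> z) * deriv \<psi> z"
    using assms by (intro deriv_chain) (auto simp: holomorphic_on_imp_differentiable_at image_subset_iff)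
  then show ?thesis
    by (simp add: norm_mult)
qed

text \<open>Conformal invariance of the hyperbolic derivative |\<psi>'| / (1 - |\<psi>|^2):
  composing \<psi> with an automorphism does not change it. It lets \<psi>' be replaced by the
  derivative of \<open>disc_aut u \<circ> \<psi>\<close> in the kernel.\<close>

lemma norm_deriv_disc_aut_comp:
  assumes hol: "\<psi> holomorphic_on unit_disc" and sub: "\<psi> ` unit_disc \<subseteq> unit_disc"
    and u: "norm u < 1" and z: "norm z < 1"
  shows "norm (deriv \<psi> z) * (1 - (norm (disc_aut u (\<psi> z)))\<^sup>2)
    = norm (deriv (disc_aut u \<circ> \<psi>) z) * (1 - (norm (\<psi> z))\<^sup>2)"
proof -
  have p: "norm (\<psi> z) < 1" using sub z by (simp add: image_subset_iff)
  show ?thesis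
    unfolding norm_deriv_comp_disc[OF holomorphic_on_disc_aut[OF u] hol sub z]
      norm_deriv_disc_aut[OF u p, symmetric] by simp
qed

section \<open>A Hardy-type inequality for univalent maps\<close>

lemma has_real_derivative_radial:
  assumes hol: "H holomorphic_on unit_disc" and tz: "norm (of_real t * z) < 1"
  shows "((\<lambda>t. (1 - (norm (H (of_real t * z)))\<^sup>2) ^ 4) has_real_derivative
    (- 8 * (1 - (norm (H (of_real t * z)))\<^sup>2) ^ 3 * (H (of_real t * z) \<bullet> (z * deriv H (of_real t * z))))) (at t within T)"
proof -
  have "(H has_field_derivative deriv H (of_real t * z)) (at (of_real t * z))"
    using hol tz by (auto intro: holomorphic_derivI)
  moreover have "((\<lambda>t. of_real t * z) has_vector_derivative z) (at t within T)"
    by (auto intro!: derivative_eq_intros)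
  ultimately have h: "((\<lambda>t. H (of_real t * z)) has_vector_derivative (z * deriv H (of_real t * z))) (at t within T)"
    using field_vector_diff_chain_within[of "\<lambda>t. of_real t * z" z t T H "deriv H (of_real t * z)"]
    by (auto simp: comp_def has_field_derivative_at_within)
  have d: "((\<lambda>t. H (of_real t * z) \<bullet> H (of_real t * z)) has_derivative
    (\<lambda>s. H (of_real t * z) \<bullet> (s *\<^sub>R (z * deriv H (of_real t * z))) + (s *\<^sub>R (z * deriv H (of_real t * z))) \<bullet> H (of_real t * z))) (at t within T)"
    using h unfolding has_vector_derivative_def by (intro has_derivative_inner)
  have "((\<lambda>t. H (of_real t * z) \<bullet> H (of_real t * z)) has_real_derivative
     2 * (H (of_real t * z) \<bullet> (z * deriv H (of_real t * z)))) (at t within T)"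
    unfolding has_field_derivative_def
    by (rule has_derivative_eq_rhs[OF d]) (auto simp: fun_eq_iff inner_commute)
  then show ?thesis
    unfolding power2_norm_eq_inner by (auto intro!: derivative_eq_intros)
qed

lemma continuous_on_univalent_weight:
  assumes hol: "H holomorphic_on unit_disc"
  shows "continuous_on unit_disc (\<lambda>y. 8 * (1 - (norm (H y))\<^sup>2) ^ 3 * norm (deriv H y))"
proof -
  have "continuous_on unit_disc H" "continuous_on unit_disc (deriv H)"
    using hol holomorphic_deriv holomorphic_on_imp_continuous_on by blast+
  then show ?thesis
    by (intro continuous_intros)
qed

text \<open>Starting the radius at \<open>z / 2\<close> instead of \<open>0\<close> avoids a singular weight at the origin after integration.\<close>

lemma radial_estimate:
  assumes hol: "H holomorphic_on unit_disc" and sub: "H ` unit_disc \<subseteq> unit_disc" and z: "norm z < 1"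
  shows "ennreal ((1 - (norm (H z))\<^sup>2) ^ 4) \<le> ennreal ((1 - (norm (H (z / 2)))\<^sup>2) ^ 4)
    + (\<integral>\<^sup>+t. ennreal (8 * (1 - (norm (H (of_real t * z)))\<^sup>2) ^ 3 * norm (deriv H (of_real t * z)))
        \<partial>restrict_space lborel {1/2..1})"
proof -
  define Q where "Q = (\<lambda>t::real. (1 - (norm (H (of_real t * z)))\<^sup>2) ^ 4)"
  define Q' where "Q' = (\<lambda>t::real. - 8 * (1 - (norm (H (of_real t * z)))\<^sup>2) ^ 3 * (H (of_real t * z) \<bullet> (z * deriv H (of_real t * z))))"
  define q where "q = (\<lambda>t::real. 8 * (1 - (norm (H (of_real t * z)))\<^sup>2) ^ 3 * norm (deriv H (of_real t * z)))"
  have tz: "norm (of_real t * z) < 1" if "t \<in> {1/2..1}" for t :: real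
    using that z mult_left_le_one_le[of "norm z" t] by (simp add: norm_mult)
  have H1: "norm (H (of_real t * z)) < 1" if "t \<in> {1/2..1}" for t :: real
    using sub tz[OF that] by (simp add: image_subset_iff)
  have q0: "0 \<le> q t" if "t \<in> {1/2..1}" for t
    using norm_sq_less_one[OF H1[OF that]] by (simp add: q_def)
  have le: "\<bar>Q' t\<bar> \<le> q t" if t: "t \<in> {1/2..1}" for t
  proof -
    have "\<bar>H (of_real t * z) \<bullet> (z * deriv H (of_real t * z))\<bar>
        \<le> norm (H (of_real t * z)) * (norm z * norm (deriv H (of_real t * z)))"
      using Cauchy_Schwarz_ineq2[of "H (of_real t * z)" "z * deriv H (of_real t * z)"] by (simp add: norm_mult)
    also have "\<dots> \<le> 1 * (1 * norm (deriv H (of_real t * z)))"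
      using H1[OF t] z by (intro mult_mono) auto
    finally have "\<bar>H (of_real t * z) \<bullet> (z * deriv H (of_real t * z))\<bar> \<le> norm (deriv H (of_real t * z))"
      by simp
    then have "8 * (1 - (norm (H (of_real t * z)))\<^sup>2) ^ 3 * \<bar>H (of_real t * z) \<bullet> (z * deriv H (of_real t * z))\<bar> \<le> q t"
      unfolding q_def using norm_sq_less_one[OF H1[OF t]] by (intro mult_left_mono) auto
    then show ?thesis
      using norm_sq_less_one[OF H1[OF t]] by (simp add: Q'_def abs_mult)
  qed
  have "(Q' has_integral (Q 1 - Q (1/2))) {1/2..1}"
    by (rule fundamental_theorem_of_calculus)
      (use has_real_derivative_radial[OF hol tz] in \<open>auto simp: Q_def Q'_def has_real_derivative_iff_has_vector_derivative\<close>)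
  moreover have contq: "continuous_on {1/2..1} q"
  proof -
    have "continuous_on ((\<lambda>t. of_real t * z) ` {1/2..1}) (\<lambda>y. 8 * (1 - (norm (H y))\<^sup>2) ^ 3 * norm (deriv H y))"
      by (rule continuous_on_subset[OF continuous_on_univalent_weight[OF hol]]) (use tz in auto)
    moreover have "continuous_on {1/2..1} (\<lambda>t. of_real t * z)"
      by (intro continuous_intros)
    ultimately have "continuous_on {1/2..1} ((\<lambda>y. 8 * (1 - (norm (H y))\<^sup>2) ^ 3 * norm (deriv H y)) \<circ> (\<lambda>t. of_real t * z))"
      by (intro continuous_on_compose)
    then show ?thesis by (simp add: q_def comp_def)
  qed
  then have hq: "(q has_integral integral {1/2..1} q) {1/2..1}"
    using integrable_continuous_real integrable_integral by blast
  ultimately have "Q 1 - Q (1/2) \<le> integral {1/2..1} q"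
    by (rule has_integral_le) (use le in \<open>auto simp: abs_le_iff\<close>)
  then have "ennreal (Q 1) \<le> ennreal (Q (1/2) + integral {1/2..1} q)"
    by (intro ennreal_leI) simp
  also have "\<dots> = ennreal (Q (1/2)) + ennreal (integral {1/2..1} q)"
    using integral_nonneg[OF has_integral_integrable[OF hq]] q0 by (intro ennreal_plus) (auto simp: Q_def)
  also have "ennreal (integral {1/2..1} q) = (\<integral>\<^sup>+t. ennreal (q t) \<partial>restrict_space lborel {1/2..1})"
  proof -
    have "(\<integral>\<^sup>+t. ennreal (indicator {1/2..1} t * q t) \<partial>lborel) = ennreal (integral {1/2..1} q)"
      by (rule nn_integral_has_integral_lebesgue[OF q0 hq])
    moreover have "ennreal (indicator {1/2..1} t * q t) = ennreal (q t) * indicator {1/2..1} t" for t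
      by (simp add: indicator_def)
    ultimately show ?thesis
      by (simp add: nn_integral_restrict_space)
  qed
  finally show ?thesis
    by (simp add: Q_def q_def)
qed

text \<open>The dilation maps the disc onto the disc of radius \<open>t\<close>, which produces the
  cut-off. Its Jacobian is t^2, and undoing it costs at most 4 because \<open>t\<close> stays above
  1/2.\<close>

lemma nn_integral_dilation_le:
  assumes q: "q \<in> borel_measurable disc_measure" and t: "1/2 \<le> t" "t \<le> 1"
  shows "(\<integral>\<^sup>+z. q (of_real t * z) \<partial>disc_measure) \<le> 4 * (\<integral>\<^sup>+y. (if norm y < t then q y else 0) \<partial>disc_measure)"
proof -
  let ?g = "\<lambda>z. of_real t * z :: complex"
  let ?F = "\<lambda>y. if norm y < t then q y else 0"
  have m: "?F \<in> borel_measurable disc_measure"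
    using q by measurable
  have "norm (?g z) < 1" if "norm z < 1" for z
    using that t mult_left_le_one_le[of "norm z" t] by (simp add: norm_mult)
  then have sub: "?g ` unit_disc \<subseteq> unit_disc"
    by auto
  moreover have "?g holomorphic_on unit_disc"
    by (intro holomorphic_intros)
  moreover have "inj_on ?g unit_disc"
    using t by (auto simp: inj_on_def)
  ultimately have cv: "(\<integral>\<^sup>+z. ?F (?g z) * ennreal ((norm (deriv ?g z))\<^sup>2) \<partial>disc_measure) \<le> (\<integral>\<^sup>+z. ?F z \<partial>disc_measure)"
    using m by (intro nn_integral_univalent_le)
  have dg: "deriv ?g z = of_real t" for z
    by (intro DERIV_imp_deriv) (auto intro!: derivative_eq_intros)
  have "?g \<in> disc_measure \<rightarrow>\<^sub>M restrict_space borel unit_disc"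
    using sub by (intro measurable_restrict_space2) auto
  then have "?g \<in> disc_measure \<rightarrow>\<^sub>M disc_measure"
    by (simp add: measurable_cong_sets[OF refl sets_disc_measure])
  then have mg: "(\<lambda>z. ?F (?g z) * ennreal ((norm (deriv ?g z))\<^sup>2)) \<in> borel_measurable disc_measure"
    unfolding dg using measurable_compose[OF _ m, of ?g] by measurable
  have "(\<integral>\<^sup>+z. q (?g z) \<partial>disc_measure) \<le> (\<integral>\<^sup>+z. 4 * (?F (?g z) * ennreal ((norm (deriv ?g z))\<^sup>2)) \<partial>disc_measure)"
  proof (rule nn_integral_mono)
    fix z assume "z \<in> space disc_measure"
    then have "?F (?g z) = q (?g z)"
      using t by (simp add: norm_mult)
    moreover have "1 \<le> 4 * ennreal ((norm (deriv ?g z))\<^sup>2)"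
    proof -
      have "(1/2)\<^sup>2 \<le> t\<^sup>2"
        using t by (intro power_mono) auto
      then have "1 \<le> 4 * (norm (deriv ?g z))\<^sup>2"
        unfolding dg by (simp add: power2_eq_square)
      then have "ennreal 1 \<le> ennreal (4 * (norm (deriv ?g z))\<^sup>2)"
        by (rule ennreal_leI)
      then show ?thesis
        by (simp add: ennreal_mult)
    qed
    ultimately show "q (?g z) \<le> 4 * (?F (?g z) * ennreal ((norm (deriv ?g z))\<^sup>2))"
      using mult_left_mono[of 1 "4 * ennreal ((norm (deriv ?g z))\<^sup>2)" "q (?g z)"]
      by (simp add: mult_ac)
  qed
  also have "\<dots> = 4 * (\<integral>\<^sup>+z. ?F (?g z) * ennreal ((norm (deriv ?g z))\<^sup>2) \<partial>disc_measure)"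
    using mg by (rule nn_integral_cmult)
  also have "\<dots> \<le> 4 * (\<integral>\<^sup>+z. ?F z \<partial>disc_measure)"
    using cv by (rule mult_left_mono) simp
  finally show ?thesis .
qed

text \<open>The radial estimate is integrated over the disc. The value at \<open>z / 2\<close> is
  comparable to the one at 0. In the double integral the dilation is undone for fixed
  \<open>t\<close>, and integrating in \<open>t\<close> for fixed \<open>y\<close> then creates the
  Hardy weight 1 - |y|.\<close>

lemma univalent_radial_integral_le:
  assumes hol: "H holomorphic_on unit_disc" and sub: "H ` unit_disc \<subseteq> unit_disc"
  defines "q \<equiv> \<lambda>y. 8 * (1 - (norm (H y))\<^sup>2) ^ 3 * norm (deriv H y)"
  shows "(\<integral>\<^sup>+z. ennreal ((1 - (norm (H z))\<^sup>2) ^ 4) \<partial>disc_measure)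
    \<le> ennreal ((4 * (1 - (norm (H 0))\<^sup>2)) ^ 4) + 4 * (\<integral>\<^sup>+y. ennreal (q y * (1 - norm y)) \<partial>disc_measure)"
proof -
  interpret D: finite_measure disc_measure
    by (rule finite_measure_disc_measure)
  define T where "T = restrict_space lborel {1/2..1::real}"
  have "finite_measure T"
    unfolding T_def
    by (rule finite_measureI) (simp add: emeasure_restrict_space space_restrict_space)
  then interpret T: finite_measure T .
  interpret DT: pair_sigma_finite disc_measure T ..
  have sT: "space T = {1/2..1}" and setsT: "sets T = sets (restrict_space borel {1/2..1})"
    by (auto simp: T_def space_restrict_space sets_restrict_space)
  have [measurable]: "(\<lambda>t. t) \<in> T \<rightarrow>\<^sub>M borel"
    unfolding measurable_cong_sets[OF setsT refl] by (auto intro: measurable_restrict_space1)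
  have contq: "continuous_on unit_disc q"
    unfolding q_def using hol by (rule continuous_on_univalent_weight)
  then have q: "(\<lambda>y. ennreal (q y)) \<in> borel_measurable disc_measure"
    by (intro measurable_compose[OF _ measurable_ennreal] continuous_on_disc_measurable)
  have tz: "norm (of_real t * z) < 1" if "t \<in> {1/2..1}" "norm z < 1" for t :: real and z :: complex
    using that mult_left_le_one_le[of "norm z" t] by (simp add: norm_mult)
  have "continuous_on (unit_disc \<times> {1/2..1}) (q \<circ> (\<lambda>(z, t::real). of_real t * z))"
    by (intro continuous_on_compose continuous_on_subset[OF contq])
      (auto simp: case_prod_unfold tz intro!: continuous_intros)
  from borel_measurable_pair_continuous_on[OF sets_disc_measure setsT this]
  have m1: "(\<lambda>(z, t). ennreal (q (of_real t * z))) \<in> borel_measurable (disc_measure \<Otimes>\<^sub>M T)"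
    using measurable_compose[OF _ measurable_ennreal] by (simp add: comp_def case_prod_unfold)
  have m2: "(\<lambda>(y, t). if norm y < t then ennreal (q y) else 0) \<in> borel_measurable (disc_measure \<Otimes>\<^sub>M T)"
    using q by measurable
  have q0: "0 \<le> q y" if "norm y < 1" for y
    using norm_sq_less_one[of "H y"] sub that by (simp add: q_def image_subset_iff)
  have "(\<integral>\<^sup>+z. ennreal ((1 - (norm (H z))\<^sup>2) ^ 4) \<partial>disc_measure)
     \<le> (\<integral>\<^sup>+z. ennreal ((4 * (1 - (norm (H 0))\<^sup>2)) ^ 4) + (\<integral>\<^sup>+t. ennreal (q (of_real t * z)) \<partial>T) \<partial>disc_measure)"
  proof (rule nn_integral_mono)
    fix z assume "z \<in> space disc_measure"
    then have z: "norm z < 1" by simp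
    have "norm (H (z/2)) < 1"
      using sub z by (simp add: image_subset_iff)
    then have "ennreal ((1 - (norm (H (z / 2)))\<^sup>2) ^ 4) \<le> ennreal ((4 * (1 - (norm (H 0))\<^sup>2)) ^ 4)"
      using one_minus_norm_sq_le_near_zero[OF hol sub, of "z/2"] z norm_sq_less_one[of "H (z/2)"]
      by (intro ennreal_leI power_mono) auto
    then show "ennreal ((1 - (norm (H z))\<^sup>2) ^ 4)
      \<le> ennreal ((4 * (1 - (norm (H 0))\<^sup>2)) ^ 4) + (\<integral>\<^sup>+t. ennreal (q (of_real t * z)) \<partial>T)"
      using radial_estimate[OF hol sub z] unfolding q_def T_def
      by (meson add_right_mono order_trans)
  qed
  also have "\<dots> = ennreal ((4 * (1 - (norm (H 0))\<^sup>2)) ^ 4) + (\<integral>\<^sup>+z. (\<integral>\<^sup>+t. ennreal (q (of_real t * z)) \<partial>T) \<partial>disc_measure)"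
    using m1 by (subst nn_integral_add) auto
  finally have 1: "(\<integral>\<^sup>+z. ennreal ((1 - (norm (H z))\<^sup>2) ^ 4) \<partial>disc_measure)
    \<le> ennreal ((4 * (1 - (norm (H 0))\<^sup>2)) ^ 4) + (\<integral>\<^sup>+z. (\<integral>\<^sup>+t. ennreal (q (of_real t * z)) \<partial>T) \<partial>disc_measure)" .
  have m3: "(\<lambda>t. \<integral>\<^sup>+y. (if norm y < t then ennreal (q y) else 0) \<partial>disc_measure) \<in> borel_measurable T"
  proof -
    have "(\<lambda>(t, y). if norm y < t then ennreal (q y) else 0) \<in> borel_measurable (T \<Otimes>\<^sub>M disc_measure)"
      using measurable_pair_swap[OF m2] by simp
    then show ?thesis
      by (rule D.borel_measurable_nn_integral)
  qed
  have 2: "(\<integral>\<^sup>+t. (\<integral>\<^sup>+y. (if norm y < t then ennreal (q y) else 0) \<partial>disc_measure) \<partial>T)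
     \<le> (\<integral>\<^sup>+y. ennreal (q y * (1 - norm y)) \<partial>disc_measure)"
    unfolding DT.Fubini'[OF m2]
  proof (rule nn_integral_mono)
    fix y assume "y \<in> space disc_measure"
    then have y: "norm y < 1" by simp
    \<comment> \<open>The admissible \<open>t\<close> lie in the interval from |y| to 1, whose
      length is the weight.\<close>
    have "(\<integral>\<^sup>+t. (if norm y < t then ennreal (q y) else 0) \<partial>T)
       \<le> (\<integral>\<^sup>+t. ennreal (q y) * indicator {norm y..1} t \<partial>lborel)"
      unfolding T_def by (subst nn_integral_restrict_space) (auto intro!: nn_integral_mono simp: indicator_def)
    also have "\<dots> = ennreal (q y * (1 - norm y))"
      using y q0[OF y] by (simp add: nn_integral_cmult_indicator ennreal_mult)
    finally show "(\<integral>\<^sup>+t. (if norm y < t then ennreal (q y) else 0) \<partial>T) \<le> ennreal (q y * (1 - norm y))" .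
  qed
  have "(\<integral>\<^sup>+z. (\<integral>\<^sup>+t. ennreal (q (of_real t * z)) \<partial>T) \<partial>disc_measure)
     = (\<integral>\<^sup>+t. (\<integral>\<^sup>+z. ennreal (q (of_real t * z)) \<partial>disc_measure) \<partial>T)"
    using DT.Fubini'[OF m1] by (rule sym)
  also have "\<dots> \<le> (\<integral>\<^sup>+t. 4 * (\<integral>\<^sup>+y. (if norm y < t then ennreal (q y) else 0) \<partial>disc_measure) \<partial>T)"
    by (rule nn_integral_mono) (use nn_integral_dilation_le[OF q] sT in auto)
  also have "\<dots> = 4 * (\<integral>\<^sup>+t. (\<integral>\<^sup>+y. (if norm y < t then ennreal (q y) else 0) \<partial>disc_measure) \<partial>T)"
    using m3 by (rule nn_integral_cmult)
  also have "\<dots> \<le> 4 * (\<integral>\<^sup>+y. ennreal (q y * (1 - norm y)) \<partial>disc_measure)"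
    using 2 by (rule mult_left_mono) simp
  finally have "(\<integral>\<^sup>+z. (\<integral>\<^sup>+t. ennreal (q (of_real t * z)) \<partial>T) \<partial>disc_measure)
    \<le> 4 * (\<integral>\<^sup>+y. ennreal (q y * (1 - norm y)) \<partial>disc_measure)" .
  from order_trans[OF 1 add_left_mono[OF this]] show ?thesis .
qed

text \<open>For injective \<open>H\<close> the Dirichlet integral is the normalized area of the
  image, which lies in a disc of mass 1.\<close>

lemma nn_integral_norm_deriv_sq_le:
  assumes "H holomorphic_on unit_disc" "H ` unit_disc \<subseteq> unit_disc" "inj_on H unit_disc"
  shows "(\<integral>\<^sup>+z. ennreal ((norm (deriv H z))\<^sup>2) \<partial>disc_measure) \<le> 1"
  using nn_integral_univalent_le[OF assms(1,3,2), of "\<lambda>_. 1"] by simp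

lemma borel_measurable_disc_holomorphic:
  assumes "H holomorphic_on unit_disc"
  shows "H \<in> borel_measurable disc_measure" "deriv H \<in> borel_measurable disc_measure"
  using assms holomorphic_deriv[OF assms] 
  by (auto intro!: continuous_on_disc_measurable holomorphic_on_imp_continuous_on)

text \<open>Hardy inequality with absorption: the gradient term is pointwise at most half of the
  integrand of \<open>X\<close> plus a multiple of c^2 |H'|^2, and univalence bounds the integral of
  |H'|^2 by 1.\<close>

lemma univalent_weight_le_base:
  assumes hol: "H holomorphic_on unit_disc" and sub: "H ` unit_disc \<subseteq> unit_disc" and inj: "inj_on H unit_disc"
  shows "(\<integral>\<^sup>+z. ennreal ((1 - (norm (H z))\<^sup>2) ^ 4) \<partial>disc_measure) \<le> ennreal (20000 * (1 - (norm (H 0))\<^sup>2)\<^sup>2)"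
proof -
  define c where "c = 1 - (norm (H 0))\<^sup>2"
  define X where "X = (\<integral>\<^sup>+z. ennreal ((1 - (norm (H z))\<^sup>2) ^ 4) \<partial>disc_measure)"
  define Y where "Y = (\<integral>\<^sup>+z. ennreal ((norm (deriv H z))\<^sup>2) \<partial>disc_measure)"
  note [measurable] = borel_measurable_disc_holomorphic[OF hol]
  have Hz: "norm (H z) < 1" if "norm z < 1" for z
    using sub that by (simp add: image_subset_iff)
  have c: "0 < c" "c \<le> 1"
    using norm_sq_less_one[OF Hz[of 0]] by (auto simp: c_def)
  have Y: "Y \<le> 1"
    unfolding Y_def using hol sub inj by (rule nn_integral_norm_deriv_sq_le)
  \<comment> \<open>Absorbing half of \<open>X\<close> into the left side requires \<open>X\<close>
    to be finite.\<close>
  have "X \<le> (\<integral>\<^sup>+z. 1 \<partial>disc_measure)"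
    unfolding X_def using norm_sq_less_one[OF Hz] by (intro nn_integral_mono) (auto simp: less_imp_le intro!: power_le_one)
  then have X1: "X \<le> 1" by simp
  have "4 * (\<integral>\<^sup>+y. ennreal (8 * (1 - (norm (H y))\<^sup>2) ^ 3 * norm (deriv H y) * (1 - norm y)) \<partial>disc_measure)
     = (\<integral>\<^sup>+y. 4 * ennreal (8 * (1 - (norm (H y))\<^sup>2) ^ 3 * norm (deriv H y) * (1 - norm y)) \<partial>disc_measure)"
    by (rule nn_integral_cmult[symmetric]) measurable
  also have "\<dots> \<le> (\<integral>\<^sup>+y. ennreal (1/2) * ennreal ((1 - (norm (H y))\<^sup>2) ^ 4)
      + ennreal (8192 * c\<^sup>2) * ennreal ((norm (deriv H y))\<^sup>2) \<partial>disc_measure)"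
  proof (rule nn_integral_mono)
    fix y assume "y \<in> space disc_measure"
    then have y: "norm y < 1" by simp
    define r d where "r = 1 - (norm (H y))\<^sup>2" and "d = norm (deriv H y)"
    have r: "0 < r" and d: "0 \<le> d"
      using norm_sq_less_one[OF Hz[OF y]] by (auto simp: r_def d_def)
    have "1 - norm y \<le> 1 - (norm y)\<^sup>2"
      using y by (simp add: power2_eq_square mult_left_le_one_le)
    then have "(1 - norm y) * r \<le> (1 - (norm y)\<^sup>2) * r"
      using r by (intro mult_right_mono) auto
    also have "\<dots> \<le> 4 * c"
      using one_minus_norm_sq_mult_le[OF hol sub y, of 0] by (simp add: disc_aut_zero_left c_def r_def)
    finally have "(1 - norm y) * r \<le> 4 * c" .
    \<comment> \<open>The exponent 4 is chosen here: the gradient carries r^3, and one further power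
      of \<open>r\<close> is spent against 1 - |y|. What remains is r^2, the square root of the
      integrand r^4.\<close>
    then have "32 * r\<^sup>2 * d * ((1 - norm y) * r) \<le> 32 * r\<^sup>2 * d * (4 * c)"
      using r d by (intro mult_left_mono) auto
    then have "4 * (8 * r ^ 3 * d * (1 - norm y)) \<le> 128 * c * r\<^sup>2 * d"
      by (simp add: power2_eq_square power3_eq_cube mult_ac)
    \<comment> \<open>AM-GM with coefficient 1/2 on r^4, whence 8192 = 128^2 / 2.\<close>
    also have "\<dots> \<le> 1/2 * r ^ 4 + 8192 * c\<^sup>2 * d\<^sup>2"
      using zero_le_power2[of "r\<^sup>2 - 128 * c * d"]
      by (simp add: power2_eq_square power4_eq_xxxx algebra_simps)
    finally have "ennreal (4 * (8 * r ^ 3 * d * (1 - norm y))) \<le> ennreal (1/2 * r ^ 4 + 8192 * c\<^sup>2 * d\<^sup>2)"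
      by (rule ennreal_leI)
    also have "ennreal (4 * (8 * r ^ 3 * d * (1 - norm y))) = 4 * ennreal (8 * r ^ 3 * d * (1 - norm y))"
      using r d y by (subst ennreal_mult) auto
    also have "ennreal (1/2 * r ^ 4 + 8192 * c\<^sup>2 * d\<^sup>2)
       = ennreal (1/2) * ennreal (r ^ 4) + ennreal (8192 * c\<^sup>2) * ennreal (d\<^sup>2)"
      using r by (subst ennreal_plus, simp, simp, subst (1 2) ennreal_mult) (auto simp del: ennreal_half)
    finally show "4 * ennreal (8 * (1 - (norm (H y))\<^sup>2) ^ 3 * norm (deriv H y) * (1 - norm y))
      \<le> ennreal (1/2) * ennreal ((1 - (norm (H y))\<^sup>2) ^ 4) + ennreal (8192 * c\<^sup>2) * ennreal ((norm (deriv H y))\<^sup>2)"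
      by (simp add: r_def d_def)
  qed
  also have "\<dots> = ennreal (1/2) * X + ennreal (8192 * c\<^sup>2) * Y"
    unfolding X_def Y_def by (simp add: nn_integral_add nn_integral_cmult)
  also have "\<dots> \<le> ennreal (1/2) * X + ennreal (8192 * c\<^sup>2) * 1"
    using Y by (intro add_left_mono mult_left_mono) auto
  finally have "X \<le> ennreal ((4 * c) ^ 4) + (ennreal (1/2) * X + ennreal (8192 * c\<^sup>2))"
    using univalent_radial_integral_le[OF hol sub] unfolding X_def c_def
    by (auto intro: order_trans[OF _ add_left_mono])
  moreover obtain x where x: "X = ennreal x" "0 \<le> x"
    using X1 by (cases X) (auto simp: top_unique)
  moreover have "ennreal (1/2) * ennreal x = ennreal (1/2 * x)"
    using x by (intro ennreal_mult[symmetric]) auto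
  ultimately have "ennreal x \<le> ennreal ((4 * c) ^ 4 + (1/2 * x + 8192 * c\<^sup>2))"
    using x c by (simp del: ennreal_half)
  then have "x \<le> (4 * c) ^ 4 + (1/2 * x + 8192 * c\<^sup>2)"
    using x by (subst (asm) ennreal_le_iff) auto
  moreover have "(4 * c) ^ 4 \<le> 256 * c\<^sup>2"
    using c power_decreasing[of 2 4 c] by (simp add: power_mult_distrib)
  \<comment> \<open>Absorption gives the constant 2 * (256 + 8192) = 16896, rounded up.\<close>
  ultimately have "x \<le> 20000 * c\<^sup>2"
    using zero_le_power2[of c] by linarith
  then show ?thesis
    using x by (simp add: X_def c_def ennreal_leI)
qed

text \<open>Since \<open>disc_aut a\<close> is an involution, \<open>H z\<close> equals
  \<open>G (disc_aut a z)\<close> with \<open>G = H \<circ> disc_aut a\<close>. The factor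
  |\<phi>_a'|^2 is exactly the Jacobian, so the case of base point 0 applies to \<open>G\<close>,
  where \<open>G 0 = H a\<close>.\<close>

lemma univalent_weight_le:
  assumes hol: "H holomorphic_on unit_disc" and sub: "H ` unit_disc \<subseteq> unit_disc" and inj: "inj_on H unit_disc"
    and a: "norm a < 1"
  shows "(\<integral>\<^sup>+z. ennreal ((1 - (norm (H z))\<^sup>2) ^ 4 * (norm (deriv (disc_aut a) z))\<^sup>2) \<partial>disc_measure)
    \<le> ennreal (20000 * (1 - (norm (H a))\<^sup>2)\<^sup>2)"
proof -
  define G where "G = H \<circ> disc_aut a"
  have G: "G holomorphic_on unit_disc" "G ` unit_disc \<subseteq> unit_disc" "inj_on G unit_disc"
    unfolding G_def
    using holomorphic_on_compose_gen[OF holomorphic_on_disc_aut[OF a] hol disc_aut_image[OF a]]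
      sub disc_aut_image[OF a] comp_inj_on[OF inj_on_disc_aut[OF a] inj_on_subset[OF inj disc_aut_image[OF a]]]
    by auto
  note [measurable] = borel_measurable_disc_holomorphic[OF G(1)]
  have "(\<integral>\<^sup>+z. ennreal ((1 - (norm (H z))\<^sup>2) ^ 4 * (norm (deriv (disc_aut a) z))\<^sup>2) \<partial>disc_measure)
    = (\<integral>\<^sup>+z. ennreal ((1 - (norm (G (disc_aut a z)))\<^sup>2) ^ 4) * ennreal ((norm (deriv (disc_aut a) z))\<^sup>2) \<partial>disc_measure)"
    using a by (intro nn_integral_cong) (simp add: G_def disc_aut_disc_aut ennreal_mult')
  also have "\<dots> \<le> (\<integral>\<^sup>+z. ennreal ((1 - (norm (G z))\<^sup>2) ^ 4) \<partial>disc_measure)"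
    using a by (intro nn_integral_univalent_le holomorphic_on_disc_aut inj_on_disc_aut disc_aut_image) measurable
  also have "\<dots> \<le> ennreal (20000 * (1 - (norm (G 0))\<^sup>2)\<^sup>2)"
    by (rule univalent_weight_le_base[OF G])
  finally show ?thesis
    by (simp add: G_def disc_aut_zero_right)
qed

section \<open>Subharmonicity\<close>

text \<open>The convex function t^p lies above its tangent at \<open>y\<close>. Being linear in
  \<open>x\<close> on the left, this form can be integrated and plays the part of Jensen's
  inequality.\<close>

lemma powr_tangent_le:
  fixes x y p :: real
  assumes "0 \<le> x" "0 \<le> y" "1 \<le> p"
  shows "p * y powr (p - 1) * x \<le> x powr p + (p - 1) * y powr p"
proof (cases "x = 0 \<or> y = 0")
  \<comment> \<open>\<open>0 powr (p - 1)\<close> is 0 also for \<open>p = 1\<close>, so the left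
    side vanishes in both cases.\<close>
  case True
  then show ?thesis using assms by auto
next
  case False
  then have xy: "x > 0" "y > 0" using assms by auto
  have "(x powr p) powr (1/p) * (y powr p) powr (1 - 1/p) \<le> 1/p * x powr p + (1 - 1/p) * y powr p"
    using assms xy by (intro Youngs_inequality_0) (auto simp: field_simps)
  moreover have "(x powr p) powr (1/p) = x"
    using xy assms by (simp add: powr_powr)
  moreover have "(y powr p) powr (1 - 1/p) = y powr (p - 1)"
  proof -
    have "p * (1 - 1/p) = p - 1" using assms by (simp add: right_diff_distrib)
    then show ?thesis by (simp add: powr_powr)
  qed
  ultimately have "x * y powr (p - 1) \<le> 1/p * x powr p + (1 - 1/p) * y powr p"
    by simp
  then have "p * (x * y powr (p - 1)) \<le> p * (1/p * x powr p + (1 - 1/p) * y powr p)"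
    using assms by (intro mult_left_mono) auto
  also have "\<dots> = x powr p + (p - 1) * y powr p"
    using assms by (simp add: field_simps)
  finally show ?thesis by (simp add: mult_ac)
qed

text \<open>Sub-mean-value property of |G|^p: Cauchy's formula gives the mean value property of
  \<open>G\<close>, the triangle inequality gives that of |G|, and convexity raises it to the power
  \<open>p\<close>.\<close>

lemma circle_mean_powr_ge:
  assumes hol: "G holomorphic_on unit_disc" and v: "norm v < 1" and p: "1 \<le> p"
  shows "ennreal (norm (G 0) powr p * (2 * pi))
    \<le> (\<integral>\<^sup>+t. ennreal (norm (G (v * cis t)) powr p) \<partial>restrict_space lborel {0..2*pi})"
proof -
  define y where "y = norm (G 0)"
  define g where "g = (\<lambda>t. G (v * cis t))"
  have vz: "norm (v * z) < 1" if "norm z \<le> 1" for z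
    using v that mult_mono[of "norm v" "norm v" "norm z" 1] by (simp add: norm_mult)
  have contG: "continuous_on unit_disc G"
    using hol holomorphic_on_imp_continuous_on by blast
  \<comment> \<open>The dilated function is holomorphic on the closed disc, so Cauchy's formula may
    be used on the unit circle.\<close>
  have "(G \<circ> (\<lambda>z. v * z)) holomorphic_on cball 0 1"
    by (rule holomorphic_on_compose_gen[OF _ hol]) (auto intro!: holomorphic_intros simp: vz)
  then have "((\<lambda>u. (G \<circ> (\<lambda>z. v * z)) u / (u - 0)) has_contour_integral (2 * of_real pi * \<i> * (G \<circ> (\<lambda>z. v * z)) 0)) (circlepath 0 1)"
    by (rule Cauchy_integral_circlepath_simple) simp
  then have "((\<lambda>t. G (v * cis t) / cis t * \<i> * cis t) has_integral (2 * of_real pi * \<i> * G 0)) {0..2*pi}"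
    unfolding circlepath_def by (subst (asm) has_contour_integral_part_circlepath_iff) (auto simp: comp_def)
  then have "((\<lambda>t. (-\<i>) * (G (v * cis t) / cis t * \<i> * cis t)) has_integral ((-\<i>) * (2 * of_real pi * \<i> * G 0))) {0..2*pi}"
    by (rule has_integral_mult_right)
  then have I: "(g has_integral (2 * of_real pi * G 0)) {0..2*pi}"
    by (simp add: g_def algebra_simps)
  have contg: "continuous_on {0..2*pi} g"
  proof -
    have "continuous_on {0..2*pi} (G \<circ> (\<lambda>t. v * cis t))"
      by (intro continuous_on_compose continuous_intros continuous_on_subset[OF contG]) (auto simp: vz)
    then show ?thesis by (simp add: g_def comp_def)
  qed
  define I1 where "I1 = integral {0..2*pi} (\<lambda>t. norm (g t))"
  define Ip where "Ip = integral {0..2*pi} (\<lambda>t. norm (g t) powr p)"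
  have i1: "((\<lambda>t. norm (g t)) has_integral I1) {0..2*pi}"
    unfolding I1_def by (intro integrable_integral integrable_continuous_real continuous_intros contg)
  have ip: "((\<lambda>t. norm (g t) powr p) has_integral Ip) {0..2*pi}"
    unfolding Ip_def using p by (intro integrable_integral integrable_continuous_real continuous_on_powr' continuous_intros contg) auto
  have "norm (2 * of_real pi * G 0) \<le> I1"
    using integral_norm_bound_integral[OF has_integral_integrable[OF I] has_integral_integrable[OF i1]]
      integral_unique[OF I] by (simp add: I1_def)
  then have y1: "2 * pi * y \<le> I1"
    by (simp add: norm_mult y_def)
  \<comment> \<open>Jensen's inequality: the tangent inequality at \<open>y = norm (G 0)\<close> is
    integrated over the circle.\<close>
  have "((\<lambda>t. p * y powr (p - 1) * norm (g t)) has_integral (p * y powr (p - 1) * I1)) {0..2*pi}"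
    using i1 by (rule has_integral_mult_right)
  moreover have "((\<lambda>t. norm (g t) powr p + (p - 1) * y powr p) has_integral (Ip + (2 * pi - 0) *\<^sub>R ((p - 1) * y powr p))) {0..2*pi}"
    using ip has_integral_const_real[of "(p - 1) * y powr p" 0 "2*pi"] by (intro has_integral_add) auto
  ultimately have "p * y powr (p - 1) * I1 \<le> Ip + (2 * pi - 0) *\<^sub>R ((p - 1) * y powr p)"
    by (rule has_integral_le) (use p in \<open>auto simp: y_def intro!: powr_tangent_le\<close>)
  moreover have "p * y powr (p - 1) * (2 * pi * y) \<le> p * y powr (p - 1) * I1"
    using y1 p by (intro mult_left_mono) (auto simp: y_def)
  moreover have "p * y powr (p - 1) * (2 * pi * y) = 2 * pi * p * y powr p"
  proof -
    have "y powr (p - 1) * y = y powr p"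
      using p powr_mult_base[of y "p - 1"] by (simp add: y_def mult.commute)
    then show ?thesis
      by (metis (no_types, lifting) mult.assoc mult.commute)
  qed
  moreover have "(2 * pi - 0) *\<^sub>R ((p - 1) * y powr p) = 2 * pi * p * y powr p - y powr p * (2 * pi)"
    by (simp add: algebra_simps)
  ultimately have "y powr p * (2 * pi) \<le> Ip"
    by linarith
  then have "ennreal (y powr p * (2 * pi)) \<le> ennreal Ip"
    by (rule ennreal_leI)
  also have "\<dots> = (\<integral>\<^sup>+t. ennreal (norm (g t) powr p) \<partial>restrict_space lborel {0..2*pi})"
  proof -
    have "(\<integral>\<^sup>+t. ennreal (indicator {0..2*pi} t * norm (g t) powr p) \<partial>lborel) = ennreal Ip"
      using ip by (intro nn_integral_has_integral_lebesgue) auto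
    moreover have "ennreal (indicator {0..2*pi} t * norm (g t) powr p) = ennreal (norm (g t) powr p) * indicator {0..2*pi} t" for t
      by (simp add: indicator_def)
    ultimately show ?thesis
      by (simp add: nn_integral_restrict_space)
  qed
  finally show ?thesis
    by (simp add: y_def g_def)
qed

text \<open>The disc measure is rotation invariant, so averaging over rotations replaces polar coordinates.\<close>

lemma radial_weight_mean_ge:
  assumes hol: "G holomorphic_on unit_disc" and p: "1 \<le> p"
    and w: "continuous_on unit_disc (\<lambda>v. w (norm v))" and w0: "\<And>r. 0 \<le> r \<Longrightarrow> r < 1 \<Longrightarrow> 0 \<le> w r"
  shows "ennreal (norm (G 0) powr p) * (\<integral>\<^sup>+v. ennreal (w (norm v)) \<partial>disc_measure)
    \<le> (\<integral>\<^sup>+v. ennreal (norm (G v) powr p * w (norm v)) \<partial>disc_measure)"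
proof -
  interpret D: finite_measure disc_measure
    by (rule finite_measure_disc_measure)
  define T where "T = restrict_space lborel {0..2*pi}"
  have emT: "emeasure T (space T) = ennreal (2 * pi)"
    unfolding T_def by (simp add: emeasure_restrict_space space_restrict_space)
  then have "finite_measure T"
    by (intro finite_measureI) simp
  then interpret T: finite_measure T .
  interpret DT: pair_sigma_finite disc_measure T ..
  have setsT: "sets T = sets (restrict_space borel {0..2*pi})"
    by (auto simp: T_def sets_restrict_space)
  define \<Phi> where "\<Phi> = (\<lambda>v. norm (G v) powr p * w (norm v))"
  have cont: "continuous_on unit_disc \<Phi>"
    unfolding \<Phi>_def using hol w p
    by (intro continuous_intros continuous_on_powr' holomorphic_on_imp_continuous_on) auto
  have wm: "(\<lambda>v. ennreal (w (norm v))) \<in> borel_measurable disc_measure"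
    using w by (intro measurable_compose[OF _ measurable_ennreal] continuous_on_disc_measurable)
  have "continuous_on (unit_disc \<times> {0..2*pi}) (\<Phi> \<circ> (\<lambda>(v, t). v * cis t))"
    by (intro continuous_on_compose continuous_on_subset[OF cont])
      (auto simp: case_prod_unfold norm_mult intro!: continuous_intros)
  from borel_measurable_pair_continuous_on[OF sets_disc_measure setsT this]
  have m1: "(\<lambda>(v, t). ennreal (\<Phi> (v * cis t))) \<in> borel_measurable (disc_measure \<Otimes>\<^sub>M T)"
    using measurable_compose[OF _ measurable_ennreal] by (simp add: comp_def case_prod_unfold)
  have \<Phi>m: "(\<lambda>v. ennreal (\<Phi> v)) \<in> borel_measurable disc_measure"
    by (intro measurable_compose[OF _ measurable_ennreal] continuous_on_disc_measurable cont)
  have rot: "(\<integral>\<^sup>+v. ennreal (\<Phi> (v * cis t)) \<partial>disc_measure) \<le> (\<integral>\<^sup>+v. ennreal (\<Phi> v) \<partial>disc_measure)" for t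
  proof -
    have d: "deriv (\<lambda>v. v * cis t) z = cis t" for z
      by (intro DERIV_imp_deriv) (auto intro!: derivative_eq_intros)
    have "(\<integral>\<^sup>+v. ennreal (\<Phi> (v * cis t)) * ennreal ((norm (deriv (\<lambda>v. v * cis t) v))\<^sup>2) \<partial>disc_measure)
      \<le> (\<integral>\<^sup>+v. ennreal (\<Phi> v) \<partial>disc_measure)"
      by (rule nn_integral_univalent_le[OF _ _ _ \<Phi>m])
        (auto intro!: holomorphic_intros simp: inj_on_def norm_mult)
    then show ?thesis
      by (simp add: d)
  qed
  \<comment> \<open>The factor \<open>2 * pi\<close> is the total mass of the angles; it is kept on
    both sides and cancelled at the end.\<close>
  have "ennreal (2 * pi) * (ennreal (norm (G 0) powr p) * (\<integral>\<^sup>+v. ennreal (w (norm v)) \<partial>disc_measure))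
    = (\<integral>\<^sup>+v. ennreal (norm (G 0) powr p * (2 * pi)) * ennreal (w (norm v)) \<partial>disc_measure)"
    by (subst nn_integral_cmult[OF wm], subst ennreal_mult) (auto simp: mult_ac)
  also have "\<dots> \<le> (\<integral>\<^sup>+v. (\<integral>\<^sup>+t. ennreal (\<Phi> (v * cis t)) \<partial>T) \<partial>disc_measure)"
  proof (rule nn_integral_mono)
    fix v assume "v \<in> space disc_measure"
    then have v: "norm v < 1" by simp
    have m: "(\<lambda>t. ennreal (norm (G (v * cis t)) powr p)) \<in> borel_measurable T"
    proof -
      have "continuous_on {0..2*pi} (G \<circ> (\<lambda>t. v * cis t))"
        using hol v by (intro continuous_on_compose continuous_intros continuous_on_subset[OF holomorphic_on_imp_continuous_on[OF hol]])
          (auto simp: norm_mult)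
      then have "continuous_on {0..2*pi} (\<lambda>t. norm (G (v * cis t)) powr p)"
        using p by (intro continuous_on_powr' continuous_intros) (auto simp: comp_def)
      from borel_measurable_continuous_on_restrict[OF this] show ?thesis
        unfolding measurable_cong_sets[OF setsT refl] by measurable
    qed
    have "ennreal (norm (G 0) powr p * (2 * pi)) * ennreal (w (norm v))
       \<le> (\<integral>\<^sup>+t. ennreal (norm (G (v * cis t)) powr p) \<partial>T) * ennreal (w (norm v))"
      unfolding T_def by (intro mult_right_mono circle_mean_powr_ge hol v p) simp
    also have "\<dots> = (\<integral>\<^sup>+t. ennreal (norm (G (v * cis t)) powr p) * ennreal (w (norm v)) \<partial>T)"
      using m by (rule nn_integral_multc[symmetric])
    also have "\<dots> = (\<integral>\<^sup>+t. ennreal (\<Phi> (v * cis t)) \<partial>T)"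
      using w0[of "norm v"] v by (intro nn_integral_cong) (simp add: \<Phi>_def norm_mult ennreal_mult)
    finally show "ennreal (norm (G 0) powr p * (2 * pi)) * ennreal (w (norm v)) \<le> (\<integral>\<^sup>+t. ennreal (\<Phi> (v * cis t)) \<partial>T)" .
  qed
  also have "\<dots> = (\<integral>\<^sup>+t. (\<integral>\<^sup>+v. ennreal (\<Phi> (v * cis t)) \<partial>disc_measure) \<partial>T)"
    using DT.Fubini'[OF m1] by (rule sym)
  also have "\<dots> \<le> (\<integral>\<^sup>+t. (\<integral>\<^sup>+v. ennreal (\<Phi> v) \<partial>disc_measure) \<partial>T)"
    by (intro nn_integral_mono rot)
  also have "\<dots> = ennreal (2 * pi) * (\<integral>\<^sup>+v. ennreal (\<Phi> v) \<partial>disc_measure)"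
    by (simp add: emT mult.commute)
  finally show ?thesis
    unfolding \<Phi>_def by (subst (asm) ennreal_mult_le_mult_iff) auto
qed

text \<open>Only |v| < 1/2 is kept: there the weight is at least (3/4)^5, because p + 3 is at most
  5, and this disc has normalized area 1/4. The product times 20 exceeds 1.\<close>

lemma nn_integral_weight_ge:
  assumes "p \<le> (2::real)"
  shows "1 \<le> 20 * (\<integral>\<^sup>+v. ennreal ((1 - (norm v)\<^sup>2) powr (p + 3)) \<partial>disc_measure)"
proof -
  have B: "ball 0 (1/2) \<in> sets disc_measure"
    unfolding sets_disc_measure sets_restrict_space
    by (rule image_eqI[where x="ball 0 (1/2)"]) auto
  have "ennreal ((3/4)^5) * emeasure disc_measure (ball 0 (1/2)) = (\<integral>\<^sup>+v. ennreal ((3/4)^5) * indicator (ball 0 (1/2)) v \<partial>disc_measure)"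
    using B by (simp add: nn_integral_cmult_indicator)
  also have "\<dots> \<le> (\<integral>\<^sup>+v. ennreal ((1 - (norm v)\<^sup>2) powr (p + 3)) \<partial>disc_measure)"
  proof (intro nn_integral_mono)
    fix v :: complex
    have "(3/4)^5 \<le> (1 - (norm v)\<^sup>2) powr (p + 3)" if v: "norm v < 1/2"
    proof -
      have "(norm v)\<^sup>2 \<le> (1/2)\<^sup>2"
        using v by (intro power_mono) auto
      then have v2: "3/4 \<le> 1 - (norm v)\<^sup>2"
        by (simp add: power2_eq_square)
      have "(3/4)^5 \<le> (1 - (norm v)\<^sup>2)^5"
        using v2 by (intro power_mono) auto
      also have "\<dots> = (1 - (norm v)\<^sup>2) powr 5"
        using v2 by (simp add: powr_numeral)
      also have "\<dots> \<le> (1 - (norm v)\<^sup>2) powr (p + 3)"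
        using v2 assms by (intro powr_mono') auto
      finally show ?thesis .
    qed
    then show "ennreal ((3/4)^5) * indicator (ball 0 (1/2)) v \<le> ennreal ((1 - (norm v)\<^sup>2) powr (p + 3))"
      by (auto simp: indicator_def intro: ennreal_leI)
  qed
  finally have le: "ennreal ((3/4)^5) * emeasure disc_measure (ball 0 (1/2)) \<le> (\<integral>\<^sup>+v. ennreal ((1 - (norm v)\<^sup>2) powr (p + 3)) \<partial>disc_measure)" .
  have "emeasure disc_measure (ball 0 (1/2)) = ennreal (1/4)"
    using B by (simp add: emeasure_disc_measure emeasure_ball unit_ball_vol_2 power2_eq_square flip: ennreal_mult)
  then have "20 * (ennreal ((3/4)^5) * emeasure disc_measure (ball 0 (1/2))) = ennreal (20 * ((3/4)^5 * (1/4)))"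
    by (subst ennreal_mult, simp, simp, subst ennreal_mult) simp_all
  moreover have "1 \<le> ennreal (20 * ((3/4)^5 * (1/4)))"
    by (subst ennreal_1[symmetric], rule ennreal_leI) (simp add: power_divide)
  ultimately have "1 \<le> 20 * (ennreal ((3/4)^5) * emeasure disc_measure (ball 0 (1/2)))"
    by simp
  also have "\<dots> \<le> 20 * (\<integral>\<^sup>+v. ennreal ((1 - (norm v)\<^sup>2) powr (p + 3)) \<partial>disc_measure)"
    using le by (rule mult_left_mono) simp
  finally show ?thesis .
qed

text \<open>The weighted sub-mean-value inequality for the derivative of
  \<open>f \<circ> disc_aut w\<close> at 0, followed by the substitution u = \<phi>_w(v). The weight
  exponent p + 3 = (p - 2) + 5 is what leaves five powers of 1 - |\<phi>_w(u)|^2, enough decay for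
  the kernel estimates.\<close>

lemma norm_deriv_powr_le:
  assumes hol: "f holomorphic_on unit_disc" and w: "norm w < 1" and p: "1 \<le> p" "p \<le> 2"
  shows "ennreal ((norm (deriv f w) * (1 - (norm w)\<^sup>2)) powr p)
    \<le> 20 * (\<integral>\<^sup>+u. ennreal (norm (deriv f u) powr p * (1 - (norm u)\<^sup>2) powr (p - 2)
            * (1 - (norm (disc_aut w u))\<^sup>2) ^ 5) \<partial>disc_measure)"
proof -
  define F where "F = f \<circ> disc_aut w"
  define W where "W = (\<integral>\<^sup>+v. ennreal ((1 - (norm v)\<^sup>2) powr (p + 3)) \<partial>disc_measure)"
  define \<Phi> where "\<Phi> = (\<lambda>u. norm (deriv f u) powr p * (1 - (norm u)\<^sup>2) powr (p - 2) * (1 - (norm (disc_aut w u))\<^sup>2) ^ 5)"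
  have F: "F holomorphic_on unit_disc"
    unfolding F_def using holomorphic_on_compose_gen[OF holomorphic_on_disc_aut[OF w] hol disc_aut_image[OF w]] .
  have dF: "norm (deriv F v) = norm (deriv f (disc_aut w v)) * norm (deriv (disc_aut w) v)" if "norm v < 1" for v
    unfolding F_def using norm_deriv_comp_disc[OF hol holomorphic_on_disc_aut[OF w] disc_aut_image[OF w] that] .
  have F0: "norm (deriv F 0) = norm (deriv f w) * (1 - (norm w)\<^sup>2)"
    using dF[of 0] w norm_deriv_disc_aut_eq[OF w, of 0] by (simp add: disc_aut_zero_right)
  note [measurable] = borel_measurable_disc_holomorphic[OF hol] borel_measurable_disc_holomorphic[OF holomorphic_on_disc_aut[OF w]]
  have \<Phi>m: "(\<lambda>u. ennreal (\<Phi> u)) \<in> borel_measurable disc_measure"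
    unfolding \<Phi>_def by measurable
  have eq: "norm (deriv F v) powr p * (1 - (norm v)\<^sup>2) powr (p + 3)
     = \<Phi> (disc_aut w v) * (norm (deriv (disc_aut w) v))\<^sup>2" if v: "norm v < 1" for v
  proof -
    define s d where "s = 1 - (norm v)\<^sup>2" and "d = norm (deriv (disc_aut w) v)"
    have s: "s > 0"
      using norm_sq_less_one[OF v] by (simp add: s_def)
    have ds: "d * s = 1 - (norm (disc_aut w v))\<^sup>2"
      using norm_deriv_disc_aut[OF w v] by (simp add: d_def s_def)
    then have d: "d > 0"
      using norm_sq_less_one[OF norm_disc_aut_less_one[OF w v]] s zero_less_mult_pos2[of d s] by simp
    have "\<Phi> (disc_aut w v) * d\<^sup>2 = norm (deriv f (disc_aut w v)) powr p * ((d * s) powr (p - 2) * s ^ 5 * d\<^sup>2)"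
      unfolding \<Phi>_def ds[symmetric] disc_aut_disc_aut[OF w v] by (simp add: s_def mult_ac)
    also have "(d * s) powr (p - 2) * s ^ 5 * d\<^sup>2 = (d powr (p - 2) * d powr 2) * (s powr (p - 2) * s powr 5)"
      using d s by (simp add: powr_mult powr_numeral)
    also have "\<dots> = d powr p * s powr (p + 3)"
      by (simp add: powr_add[symmetric] add.commute)
    finally show ?thesis
      using dF[OF v] d by (simp add: powr_mult d_def s_def mult_ac)
  qed
  have "ennreal (norm (deriv F 0) powr p) * 1 \<le> ennreal (norm (deriv F 0) powr p) * (20 * W)"
    unfolding W_def using nn_integral_weight_ge[OF p(2)] by (intro mult_left_mono) auto
  also have "\<dots> = 20 * (ennreal (norm (deriv F 0) powr p) * W)"
    by (simp add: mult_ac)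
  also have "ennreal (norm (deriv F 0) powr p) * W
     \<le> (\<integral>\<^sup>+v. ennreal (norm (deriv F v) powr p * (1 - (norm v)\<^sup>2) powr (p + 3)) \<partial>disc_measure)"
    unfolding W_def
    by (rule radial_weight_mean_ge[of "deriv F" p "\<lambda>r. (1 - r\<^sup>2) powr (p + 3)"])
      (use F p in \<open>auto intro!: holomorphic_deriv continuous_intros continuous_on_powr' less_imp_le[OF norm_sq_less_one]\<close>)
  also have "\<dots> = (\<integral>\<^sup>+v. ennreal (\<Phi> (disc_aut w v)) * ennreal ((norm (deriv (disc_aut w) v))\<^sup>2) \<partial>disc_measure)"
    by (intro nn_integral_cong) (simp add: eq ennreal_mult'')
  also have "\<dots> \<le> (\<integral>\<^sup>+u. ennreal (\<Phi> u) \<partial>disc_measure)"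
    using w \<Phi>m by (intro nn_integral_univalent_le holomorphic_on_disc_aut inj_on_disc_aut disc_aut_image)
  finally show ?thesis
    by (simp add: F0 \<Phi>_def mult_left_mono)
qed

section \<open>The kernel of the composition operator\<close>

text \<open>
  The weight with which \<open>\<bar>f'(u)\<bar> powr p * (1 - \<bar>u\<bar>\<^sup>2) powr (p - 2)\<close> contributes to
  the integrand of \<open>bmoa_integral p (f \<circ> \<psi>) a\<close> at \<open>z\<close> once \<open>\<bar>f'(\<psi> z)\<bar> powr p\<close> is
  estimated by \<open>norm_deriv_powr_le\<close>.
\<close>

definition comp_kernel :: "real \<Rightarrow> (complex \<Rightarrow> complex) \<Rightarrow> complex \<Rightarrow> complex \<Rightarrow> complex \<Rightarrow> real" where
  "comp_kernel p \<psi> a u z = norm (deriv \<psi> z) powr p * (1 - (norm z)\<^sup>2) powr (p - 2)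
     * (1 - (norm (disc_aut a z))\<^sup>2) * (1 - (norm (\<psi> z))\<^sup>2) powr (- p)
     * (1 - (norm (disc_aut u (\<psi> z)))\<^sup>2) ^ 5"

text \<open>Crude Young inequality: both bases are at most the larger one and the exponents add up
  to 2.\<close>

lemma powr_mult_powr_le:
  fixes x y p :: real
  assumes "0 \<le> x" "0 \<le> y" "0 \<le> p" "p \<le> 2"
  shows "x powr p * y powr (2 - p) \<le> x\<^sup>2 + y\<^sup>2"
proof -
  define m where "m = max x y"
  have m: "0 \<le> m" "x \<le> m" "y \<le> m"
    using assms by (auto simp: m_def)
  have "x powr p * y powr (2 - p) \<le> m powr p * m powr (2 - p)"
    using assms m by (intro mult_mono powr_mono2) auto
  also have "\<dots> = m powr 2"
    by (simp add: powr_add[symmetric])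
  also have "\<dots> = m\<^sup>2"
    using m by (simp add: powr_numeral)
  also have "\<dots> \<le> x\<^sup>2 + y\<^sup>2"
    by (simp add: m_def max_def)
  finally show ?thesis .
qed

text \<open>Used with \<open>g\<close> = |\<phi>_a'(z)| and \<open>s\<close> = 1 - |z|^2, when
  \<open>g * s\<close> = 1 - |\<phi>_a(z)|^2 is at most 1. It exchanges the singular weight s^(p-2)
  for g^(2-p), which Young's inequality can pair with |H'|^p.\<close>

lemma powr_weight_split:
  fixes g s p :: real
  assumes g: "0 < g" and s: "0 < s"
  shows "s powr (p - 2) * (g * s) = (g * s) powr (p - 1) * g powr (2 - p)"
proof -
  have "(g * s) powr (p - 1) * g powr (2 - p) = (g powr (p - 1) * g powr (2 - p)) * s powr (p - 1)"
    using g s by (simp add: powr_mult mult_ac)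
  also have "g powr (p - 1) * g powr (2 - p) = g"
    using g by (simp add: powr_add[symmetric])
  also have "s powr (p - 1) = s powr (p - 2) * s"
    using s powr_add[of s "p - 2" 1] by simp
  finally show ?thesis by (simp add: mult_ac)
qed

text \<open>Conformal invariance rewrites |\<psi>'| in terms of |H'|. The weight is then split, and
  Schwarz-Pick bounds (1 - |\<phi>_a|^2)^(p-1) by a multiple of (c / h)^(p-1). Young's inequality
  applied to \<open>x\<close> and \<open>h\<^sup>2 * g / c\<close> gives the two terms.\<close>

lemma comp_kernel_le:
  assumes hol: "\<psi> holomorphic_on unit_disc" and sub: "\<psi> ` unit_disc \<subseteq> unit_disc"
    and inj: "inj_on \<psi> unit_disc" and u: "norm u < 1" and a: "norm a < 1" and z: "norm z < 1"
    and p: "1 \<le> p" "p < 2"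
  defines "H \<equiv> disc_aut u \<circ> \<psi>" and "c \<equiv> 1 - (norm (disc_aut u (\<psi> a)))\<^sup>2"
  shows "comp_kernel p \<psi> a u z \<le> 4 * c * (norm (deriv H z))\<^sup>2
    + 4 / c * ((1 - (norm (H z))\<^sup>2) ^ 4 * (norm (deriv (disc_aut a) z))\<^sup>2)"
proof -
  note H = univalent_disc_aut_comp[OF hol sub inj u, folded H_def]
  define h x s g r d where "h = 1 - (norm (H z))\<^sup>2" and "x = norm (deriv H z)" and "s = 1 - (norm z)\<^sup>2"
    and "g = norm (deriv (disc_aut a) z)" and "r = 1 - (norm (\<psi> z))\<^sup>2" and "d = norm (deriv \<psi> z)"
  have \<psi>z: "norm (\<psi> z) < 1" "norm (\<psi> a) < 1" "norm (H z) < 1"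
    using sub H(2) z a by (auto simp: image_subset_iff)
  have h: "0 < h" "h \<le> 1" and s: "0 < s" and r: "0 < r" and x: "0 \<le> x" and d: "0 \<le> d" and c: "0 < c"
    using norm_sq_less_one \<psi>z z norm_disc_aut_less_one[OF u \<psi>z(2)]
    by (auto simp: h_def s_def r_def x_def d_def c_def)
  have gs: "g * s = 1 - (norm (disc_aut a z))\<^sup>2"
    using norm_deriv_disc_aut[OF a z] by (simp add: g_def s_def)
  then have "0 < g * s"
    using norm_sq_less_one[OF norm_disc_aut_less_one[OF a z]] by simp
  then have g: "0 < g"
    using s by (simp add: zero_less_mult_iff)
  have gsh: "g * s * h \<le> 4 * c"
    using one_minus_norm_sq_mult_le[OF H(1,2) z a] by (simp add: gs h_def c_def H_def)
  have "d * h = x * r"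
    using norm_deriv_disc_aut_comp[OF hol sub u z] by (simp add: d_def h_def x_def r_def H_def)
  then have "d powr p * h powr p = x powr p * r powr p"
    by (metis powr_mult)
  then have dp: "d powr p * r powr (- p) = x powr p * h powr (- p)"
    using h r by (simp add: powr_minus divide_simps)
  have "s powr (p - 2) * (g * s) = (g * s) powr (p - 1) * g powr (2 - p)"
    by (rule powr_weight_split[OF g s])
  then have "comp_kernel p \<psi> a u z = x powr p * h powr (- p) * h ^ 5 * ((g * s) powr (p - 1) * g powr (2 - p))"
    unfolding dp[symmetric]
    unfolding comp_kernel_def gs[symmetric]
    by (simp add: d_def s_def r_def h_def H_def mult_ac)
  also have "\<dots> \<le> x powr p * h powr (- p) * h ^ 5 * ((4 * c powr (p - 1) * h powr (1 - p)) * g powr (2 - p))"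
  proof (intro mult_left_mono mult_right_mono)
    have "(g * s) powr (p - 1) \<le> (4 * c / h) powr (p - 1)"
      using gsh h g s p by (intro powr_mono2) (auto simp: field_simps)
    also have "\<dots> = 4 powr (p - 1) * (c powr (p - 1) * h powr (1 - p))"
    proof -
      have "h powr (1 - p) = 1 / h powr (p - 1)"
        using powr_minus_divide[of h "p - 1"] by simp
      then show ?thesis
        using c h by (simp add: powr_mult powr_divide)
    qed
    also have "\<dots> \<le> 4 powr 1 * (c powr (p - 1) * h powr (1 - p))"
      using p by (intro mult_right_mono powr_mono) auto
    finally show "(g * s) powr (p - 1) \<le> 4 * c powr (p - 1) * h powr (1 - p)"
      by simp
  qed (use h in auto)
  also have "\<dots> = 4 * c powr (p - 1) * x powr p * g powr (2 - p) * (h powr (- p) * h powr 5 * h powr (1 - p))"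
    using h by (simp add: powr_numeral mult_ac)
  also have "h powr (- p) * h powr 5 * h powr (1 - p) = h powr (6 - 2 * p)"
    by (simp add: powr_add[symmetric])
  \<comment> \<open>Two powers of \<open>h\<close>, which is at most 1, are given away so that the
    remaining exponent is 2 (2 - p) and \<open>h\<^sup>2\<close> joins \<open>g\<close> under one
    power.\<close>
  also have "4 * c powr (p - 1) * x powr p * g powr (2 - p) * h powr (6 - 2 * p)
     \<le> 4 * c powr (p - 1) * x powr p * g powr (2 - p) * h powr (2 * (2 - p))"
    using h p by (intro mult_left_mono powr_mono') auto
  also have "\<dots> = 4 * c * (x powr p * (h\<^sup>2 * g / c) powr (2 - p))"
  proof -
    have "h powr (2 * (2 - p)) = (h\<^sup>2) powr (2 - p)"
      using h powr_powr[of h 2 "2 - p"] by (simp only: powr_numeral less_imp_le)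
    moreover have "c powr (p - 1) = c * (1 / c powr (2 - p))"
    proof -
      have "c powr (p - 1) * c powr (2 - p) = c"
        using c by (simp add: powr_add[symmetric])
      then show ?thesis
        using c by (simp add: field_simps)
    qed
    ultimately show ?thesis
      using h g c by (simp add: powr_mult powr_divide)
  qed
  also have "\<dots> \<le> 4 * c * (x\<^sup>2 + (h\<^sup>2 * g / c)\<^sup>2)"
    using x h g c p by (intro mult_left_mono powr_mult_powr_le) auto
  also have "\<dots> = 4 * c * x\<^sup>2 + 4 / c * (h ^ 4 * g\<^sup>2)"
    using c by (simp add: field_simps power2_eq_square power4_eq_xxxx)
  finally show ?thesis
    by (simp add: x_def h_def g_def)
qed

text \<open>The first term of the pointwise bound integrates to at most 4c by the area bound. In the
  second, the factor c^2 from \<open>univalent_weight_le\<close> pays for the division by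
  \<open>c\<close>, leaving 80000c.\<close>

lemma nn_integral_comp_kernel_le:
  assumes hol: "\<psi> holomorphic_on unit_disc" and sub: "\<psi> ` unit_disc \<subseteq> unit_disc"
    and inj: "inj_on \<psi> unit_disc" and u: "norm u < 1" and a: "norm a < 1"
    and p: "1 \<le> p" "p < 2"
  shows "(\<integral>\<^sup>+z. ennreal (comp_kernel p \<psi> a u z) \<partial>disc_measure) \<le> ennreal (100000 * (1 - (norm (disc_aut (\<psi> a) u))\<^sup>2))"
proof -
  define H where "H = disc_aut u \<circ> \<psi>"
  define c where "c = 1 - (norm (disc_aut u (\<psi> a)))\<^sup>2"
  have "norm (\<psi> a) < 1"
    using sub a by (simp add: image_subset_iff)
  then have c: "0 < c"
    unfolding c_def using norm_sq_less_one[OF norm_disc_aut_less_one[OF u]] by simp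
  note H = univalent_disc_aut_comp[OF hol sub inj u, folded H_def]
  note [measurable] = borel_measurable_disc_holomorphic[OF H(1)]
    borel_measurable_disc_holomorphic[OF holomorphic_on_disc_aut[OF a]]
  have "(\<integral>\<^sup>+z. ennreal (comp_kernel p \<psi> a u z) \<partial>disc_measure)
    \<le> (\<integral>\<^sup>+z. ennreal (4 * c) * ennreal ((norm (deriv H z))\<^sup>2)
       + ennreal (4 / c) * ennreal ((1 - (norm (H z))\<^sup>2) ^ 4 * (norm (deriv (disc_aut a) z))\<^sup>2) \<partial>disc_measure)"
  proof (rule nn_integral_mono)
    fix z assume "z \<in> space disc_measure"
    then have z: "norm z < 1" by simp
    have "norm (H z) < 1"
      using H(2) z by (simp add: image_subset_iff)
    then have "0 \<le> (1 - (norm (H z))\<^sup>2) ^ 4 * (norm (deriv (disc_aut a) z))\<^sup>2"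
      using norm_sq_less_one[of "H z"] by simp
    then show "ennreal (comp_kernel p \<psi> a u z) \<le> ennreal (4 * c) * ennreal ((norm (deriv H z))\<^sup>2)
       + ennreal (4 / c) * ennreal ((1 - (norm (H z))\<^sup>2) ^ 4 * (norm (deriv (disc_aut a) z))\<^sup>2)"
      using ennreal_leI[OF comp_kernel_le[OF hol sub inj u a z p]] c
      by (subst (1 2) ennreal_mult[symmetric]) (auto simp: H_def c_def ennreal_plus[symmetric] simp del: ennreal_plus)
  qed
  also have "\<dots> = ennreal (4 * c) * (\<integral>\<^sup>+z. ennreal ((norm (deriv H z))\<^sup>2) \<partial>disc_measure)
       + ennreal (4 / c) * (\<integral>\<^sup>+z. ennreal ((1 - (norm (H z))\<^sup>2) ^ 4 * (norm (deriv (disc_aut a) z))\<^sup>2) \<partial>disc_measure)"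
    by (subst nn_integral_add, measurable) (simp add: nn_integral_cmult)
  also have "\<dots> \<le> ennreal (4 * c) * ennreal 1 + ennreal (4 / c) * ennreal (20000 * c\<^sup>2)"
    using nn_integral_norm_deriv_sq_le[OF H] univalent_weight_le[OF H a]
    by (intro add_mono mult_left_mono) (auto simp: H_def c_def)
  also have "\<dots> = ennreal (4 * c + 4 / c * (20000 * c\<^sup>2))"
    using c by (subst (1 2) ennreal_mult[symmetric]) (auto simp: ennreal_plus[symmetric] simp del: ennreal_plus)
  also have "\<dots> \<le> ennreal (100000 * c)"
    using c by (intro ennreal_leI) (simp add: power2_eq_square)
  finally show ?thesis
    by (simp add: c_def norm_disc_aut_commute[of u])
qed

text \<open>Serves the measurability required for exchanging the integrals. The real powers are
  continuous because their bases are positive inside the disc.\<close>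

lemma continuous_on_comp_kernel:
  assumes hol: "\<psi> holomorphic_on unit_disc" and sub: "\<psi> ` unit_disc \<subseteq> unit_disc" and a: "norm a < 1" and p: "1 \<le> p"
  shows "continuous_on (unit_disc \<times> unit_disc) (\<lambda>(z, u). comp_kernel p \<psi> a u z)"
proof -
  have \<psi>z: "norm (\<psi> z) < 1" if "norm z < 1" for z
    using sub that by (simp add: image_subset_iff)
  have 1: "continuous_on (unit_disc \<times> unit_disc) (\<lambda>x. g (fst x))" if "continuous_on unit_disc g" for g :: "complex \<Rightarrow> complex"
  proof -
    have "continuous_on (unit_disc \<times> unit_disc) (g \<circ> fst)"
      by (intro continuous_on_compose continuous_intros continuous_on_subset[OF that]) auto
    then show ?thesis by (simp add: comp_def)
  qed
  note c = 1[OF holomorphic_on_imp_continuous_on[OF hol]]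
    1[OF holomorphic_on_imp_continuous_on[OF holomorphic_deriv[OF hol open_ball]]]
    1[OF holomorphic_on_imp_continuous_on[OF holomorphic_on_disc_aut[OF a]]]
  have "continuous_on (unit_disc \<times> unit_disc) (\<lambda>x. disc_aut (snd x) (\<psi> (fst x)))"
    unfolding disc_aut_def by (intro continuous_intros c) (use disc_aut_denom_nonzero \<psi>z in auto)
  moreover have "\<forall>x\<in>unit_disc \<times> unit_disc. 0 \<le> 1 - (norm (fst x))\<^sup>2 \<and> (1 - (norm (fst x))\<^sup>2 = 0 \<longrightarrow> 0 < p - 2)"
    using norm_sq_less_one by (fastforce intro: less_imp_le)
  moreover have "\<forall>x\<in>unit_disc \<times> unit_disc. 0 \<le> 1 - (norm (\<psi> (fst x)))\<^sup>2 \<and> (1 - (norm (\<psi> (fst x)))\<^sup>2 = 0 \<longrightarrow> 0 < - p)"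
    using norm_sq_less_one[OF \<psi>z] by (fastforce intro: less_imp_le)
  ultimately show ?thesis
    unfolding comp_kernel_def case_prod_unfold using p
    by (intro continuous_on_mult continuous_on_power continuous_on_diff continuous_on_const continuous_on_norm
        continuous_on_powr' continuous_on_fst continuous_on_id c) auto
qed

text \<open>For each \<open>z\<close> the bound \<open>norm_deriv_powr_le\<close> is applied at the
  point \<psi>(z), and Tonelli's theorem brings the integral over \<open>u\<close> outside.\<close>

lemma bmoa_integral_comp_le_kernel:
  assumes f: "f holomorphic_on unit_disc"
    and hol: "\<psi> holomorphic_on unit_disc" and sub: "\<psi> ` unit_disc \<subseteq> unit_disc"
    and a: "norm a < 1" and p: "1 \<le> p" "p < 2"
  shows "bmoa_integral p (f \<circ> \<psi>) a \<le> 20 * (\<integral>\<^sup>+u. ennreal (norm (deriv f u) powr p * (1 - (norm u)\<^sup>2) powr (p - 2))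
      * (\<integral>\<^sup>+z. ennreal (comp_kernel p \<psi> a u z) \<partial>disc_measure) \<partial>disc_measure)"
proof -
  interpret D: finite_measure disc_measure
    by (rule finite_measure_disc_measure)
  interpret DD: pair_sigma_finite disc_measure disc_measure ..
  define E where "E = (\<lambda>u. norm (deriv f u) powr p * (1 - (norm u)\<^sup>2) powr (p - 2))"
  \<comment> \<open>\<open>V\<close> collects the factors of the kernel that are free of
    \<open>u\<close>; its power of exponent -p cancels the factor (1 - |\<psi>(z)|^2)^p introduced
    by \<open>norm_deriv_powr_le\<close>.\<close>
  define V where "V = (\<lambda>z. norm (deriv \<psi> z) powr p * (1 - (norm z)\<^sup>2) powr (p - 2) * (1 - (norm (disc_aut a z))\<^sup>2) * (1 - (norm (\<psi> z))\<^sup>2) powr (- p))"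
  have \<psi>z: "norm (\<psi> z) < 1" if "norm z < 1" for z
    using sub that by (simp add: image_subset_iff)
  have E0: "0 \<le> E u" for u
    by (simp add: E_def)
  have V0: "0 \<le> V z" if "norm z < 1" for z
    using norm_sq_less_one[OF norm_disc_aut_less_one[OF a that]] by (simp add: V_def)
  note [measurable] = borel_measurable_disc_holomorphic[OF f] borel_measurable_disc_holomorphic[OF hol]
    borel_measurable_disc_holomorphic[OF holomorphic_on_disc_aut[OF a]]
  have Em [measurable]: "(\<lambda>u. ennreal (E u)) \<in> borel_measurable disc_measure"
    unfolding E_def by measurable
  have km [measurable]: "(\<lambda>(z, u). ennreal (comp_kernel p \<psi> a u z)) \<in> borel_measurable (disc_measure \<Otimes>\<^sub>M disc_measure)"
    using measurable_compose[OF borel_measurable_pair_continuous_on[OF sets_disc_measure sets_disc_measure continuous_on_comp_kernel[OF hol sub a p(1)]] measurable_ennreal]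
    by (simp add: case_prod_unfold)
  have m: "(\<lambda>(z, u). ennreal (E u) * ennreal (comp_kernel p \<psi> a u z)) \<in> borel_measurable (disc_measure \<Otimes>\<^sub>M disc_measure)"
    using km Em by (simp add: case_prod_unfold)
  have "bmoa_integral p (f \<circ> \<psi>) a \<le> (\<integral>\<^sup>+z. 20 * (\<integral>\<^sup>+u. ennreal (E u) * ennreal (comp_kernel p \<psi> a u z) \<partial>disc_measure) \<partial>disc_measure)"
    unfolding bmoa_integral_def
  proof (rule nn_integral_mono)
    fix z assume "z \<in> space disc_measure"
    then have z: "norm z < 1" by simp
    define w where "w = \<psi> z"
    have w: "norm w < 1" and r: "0 < 1 - (norm w)\<^sup>2"
      using \<psi>z[OF z] norm_sq_less_one[of w] by (auto simp: w_def)
    note [measurable] = borel_measurable_disc_holomorphic[OF holomorphic_on_disc_aut[OF w]]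
    have inv: "(1 - (norm w)\<^sup>2) powr p * (1 - (norm w)\<^sup>2) powr (- p) = 1"
      using r by (simp add: powr_minus)
    have "(norm (deriv f w) * (1 - (norm w)\<^sup>2)) powr p * V z
      = norm (deriv f w) powr p * norm (deriv \<psi> z) powr p * (1 - (norm z)\<^sup>2) powr (p - 2)
        * (1 - (norm (disc_aut a z))\<^sup>2) * ((1 - (norm w)\<^sup>2) powr p * (1 - (norm w)\<^sup>2) powr (- p))"
      unfolding powr_mult V_def w_def by (simp only: mult_ac)
    then have "norm (deriv (f \<circ> \<psi>) z) powr p * (1 - (norm z)\<^sup>2) powr (p - 2) * (1 - (norm (disc_aut a z))\<^sup>2)
      = (norm (deriv f w) * (1 - (norm w)\<^sup>2)) powr p * V z"
      unfolding inv norm_deriv_comp_disc[OF f hol sub z] powr_mult by (auto simp: w_def)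
    then have "ennreal (norm (deriv (f \<circ> \<psi>) z) powr p * (1 - (norm z)\<^sup>2) powr (p - 2) * (1 - (norm (disc_aut a z))\<^sup>2))
      = ennreal ((norm (deriv f w) * (1 - (norm w)\<^sup>2)) powr p) * ennreal (V z)"
      using V0[OF z] by (simp add: ennreal_mult)
    also have "\<dots> \<le> 20 * (\<integral>\<^sup>+u. ennreal (E u * (1 - (norm (disc_aut w u))\<^sup>2) ^ 5) \<partial>disc_measure) * ennreal (V z)"
      unfolding E_def using p by (intro mult_right_mono norm_deriv_powr_le f w) auto
    also have "\<dots> = 20 * ((\<integral>\<^sup>+u. ennreal (E u * (1 - (norm (disc_aut w u))\<^sup>2) ^ 5) \<partial>disc_measure) * ennreal (V z))"
      by (simp add: mult_ac)
    also have "(\<integral>\<^sup>+u. ennreal (E u * (1 - (norm (disc_aut w u))\<^sup>2) ^ 5) \<partial>disc_measure) * ennreal (V z)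
      = (\<integral>\<^sup>+u. ennreal (E u * (1 - (norm (disc_aut w u))\<^sup>2) ^ 5) * ennreal (V z) \<partial>disc_measure)"
      unfolding E_def by (intro nn_integral_multc[symmetric]) measurable
    also have "\<dots> = (\<integral>\<^sup>+u. ennreal (E u) * ennreal (comp_kernel p \<psi> a u z) \<partial>disc_measure)"
    proof (rule nn_integral_cong)
      fix u assume "u \<in> space disc_measure"
      then have u: "norm u < 1" by simp
      have "comp_kernel p \<psi> a u z = (1 - (norm (disc_aut w u))\<^sup>2) ^ 5 * V z"
        by (simp add: comp_kernel_def V_def w_def norm_disc_aut_commute[of u])
      moreover have "0 \<le> (1 - (norm (disc_aut w u))\<^sup>2) ^ 5"
        using norm_sq_less_one[OF norm_disc_aut_less_one[OF w u]] by simp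
      ultimately show "ennreal (E u * (1 - (norm (disc_aut w u))\<^sup>2) ^ 5) * ennreal (V z) = ennreal (E u) * ennreal (comp_kernel p \<psi> a u z)"
        using E0 V0[OF z] by (simp add: ennreal_mult mult_ac)
    qed
    finally show "ennreal (norm (deriv (f \<circ> \<psi>) z) powr p * (1 - (norm z)\<^sup>2) powr (p - 2) * (1 - (norm (disc_aut a z))\<^sup>2))
      \<le> 20 * (\<integral>\<^sup>+u. ennreal (E u) * ennreal (comp_kernel p \<psi> a u z) \<partial>disc_measure)" .
  qed
  also have "\<dots> = 20 * (\<integral>\<^sup>+z. (\<integral>\<^sup>+u. ennreal (E u) * ennreal (comp_kernel p \<psi> a u z) \<partial>disc_measure) \<partial>disc_measure)"
    using D.borel_measurable_nn_integral[OF m] by (rule nn_integral_cmult)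
  also have "\<dots> = 20 * (\<integral>\<^sup>+u. (\<integral>\<^sup>+z. ennreal (E u) * ennreal (comp_kernel p \<psi> a u z) \<partial>disc_measure) \<partial>disc_measure)"
    using DD.Fubini'[OF m] by simp
  also have "\<dots> = 20 * (\<integral>\<^sup>+u. ennreal (E u) * (\<integral>\<^sup>+z. ennreal (comp_kernel p \<psi> a u z) \<partial>disc_measure) \<partial>disc_measure)"
  proof -
    have "(\<lambda>z. ennreal (comp_kernel p \<psi> a u z)) \<in> borel_measurable disc_measure" if "u \<in> space disc_measure" for u
      using measurable_compose[OF measurable_Pair2'[OF that] km] by simp
    then show ?thesis
      by (intro arg_cong[where f="\<lambda>x. 20 * x"] nn_integral_cong nn_integral_cmult)
  qed
  finally show ?thesis
    by (simp add: E_def)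
qed

text \<open>The bound on the kernel integral is a multiple of 1 - |\<phi>_b(u)|^2 with b =
  \<psi>(a), which is exactly the weight in \<open>bmoa_integral p f (\<psi> a)\<close>. The
  constant is 20 * 100000.\<close>

lemma bmoa_integral_comp_le:
  assumes f: "f holomorphic_on unit_disc"
    and hol: "\<psi> holomorphic_on unit_disc" and sub: "\<psi> ` unit_disc \<subseteq> unit_disc" and inj: "inj_on \<psi> unit_disc"
    and a: "norm a < 1" and p: "1 \<le> p" "p < 2"
  shows "bmoa_integral p (f \<circ> \<psi>) a \<le> 2000000 * bmoa_integral p f (\<psi> a)"
proof -
  have \<psi>a: "norm (\<psi> a) < 1"
    using sub a by (simp add: image_subset_iff)
  note [measurable] = borel_measurable_disc_holomorphic[OF f]
    borel_measurable_disc_holomorphic[OF holomorphic_on_disc_aut[OF \<psi>a]]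
  have "(\<integral>\<^sup>+u. ennreal (norm (deriv f u) powr p * (1 - (norm u)\<^sup>2) powr (p - 2))
      * (\<integral>\<^sup>+z. ennreal (comp_kernel p \<psi> a u z) \<partial>disc_measure) \<partial>disc_measure)
    \<le> (\<integral>\<^sup>+u. 100000 * ennreal (norm (deriv f u) powr p * (1 - (norm u)\<^sup>2) powr (p - 2) * (1 - (norm (disc_aut (\<psi> a) u))\<^sup>2)) \<partial>disc_measure)"
  proof (rule nn_integral_mono)
    fix u assume "u \<in> space disc_measure"
    then have u: "norm u < 1" by simp
    have pos: "0 < 1 - (norm (disc_aut (\<psi> a) u))\<^sup>2"
      using norm_sq_less_one[OF norm_disc_aut_less_one[OF \<psi>a u]] by simp
    have eq: "ennreal e * ennreal (100000 * c) = 100000 * ennreal (e * c)" if "0 < c" "0 \<le> e" for c e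
      using that by (simp add: ennreal_mult mult_ac)
    have "ennreal (norm (deriv f u) powr p * (1 - (norm u)\<^sup>2) powr (p - 2)) * ennreal (100000 * (1 - (norm (disc_aut (\<psi> a) u))\<^sup>2))
      = 100000 * ennreal (norm (deriv f u) powr p * (1 - (norm u)\<^sup>2) powr (p - 2) * (1 - (norm (disc_aut (\<psi> a) u))\<^sup>2))"
      by (rule eq[OF pos]) simp
    then show "ennreal (norm (deriv f u) powr p * (1 - (norm u)\<^sup>2) powr (p - 2)) * (\<integral>\<^sup>+z. ennreal (comp_kernel p \<psi> a u z) \<partial>disc_measure)
      \<le> 100000 * ennreal (norm (deriv f u) powr p * (1 - (norm u)\<^sup>2) powr (p - 2) * (1 - (norm (disc_aut (\<psi> a) u))\<^sup>2))"
      using mult_left_mono[OF nn_integral_comp_kernel_le[OF hol sub inj u a p], of "ennreal (norm (deriv f u) powr p * (1 - (norm u)\<^sup>2) powr (p - 2))"]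
      by (simp only: zero_le)
  qed
  also have "\<dots> = 100000 * bmoa_integral p f (\<psi> a)"
    unfolding bmoa_integral_def by (rule nn_integral_cmult) measurable
  finally have "20 * (\<integral>\<^sup>+u. ennreal (norm (deriv f u) powr p * (1 - (norm u)\<^sup>2) powr (p - 2))
      * (\<integral>\<^sup>+z. ennreal (comp_kernel p \<psi> a u z) \<partial>disc_measure) \<partial>disc_measure) \<le> 20 * (100000 * bmoa_integral p f (\<psi> a))"
    by (intro mult_left_mono) auto
  also have "20 * (100000 * bmoa_integral p f (\<psi> a)) = 2000000 * bmoa_integral p f (\<psi> a)"
    by (simp add: mult.assoc[symmetric])
  finally show ?thesis
    using bmoa_integral_comp_le_kernel[OF f hol sub a p] by (rule order_trans[rotated])
qed

section \<open>Behaviour at the boundary\<close>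

text \<open>The measure with density \<open>h\<close> is finite and the annuli decrease to the empty
  set, so continuity from above applies.\<close>

lemma nn_integral_disc_tail:
  assumes h: "h \<in> borel_measurable disc_measure" and fin: "nn_integral disc_measure h < \<infinity>" and \<delta>: "(0::real) < \<delta>"
  obtains R where "0 < R" "R < 1" "(\<integral>\<^sup>+u. (if R < norm u then h u else 0) \<partial>disc_measure) \<le> ennreal \<delta>"
proof -
  define A where "A = (\<lambda>n. {u \<in> space disc_measure. 1 - inverse (real (Suc n)) < norm u})"
  define N where "N = density disc_measure h"
  have A: "A n \<in> sets disc_measure" for n
    unfolding A_def by measurable
  have N: "emeasure N (A n) = (\<integral>\<^sup>+u. (if 1 - inverse (real (Suc n)) < norm u then h u else 0) \<partial>disc_measure)" for n
    unfolding N_def emeasure_density[OF h A]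
    by (intro nn_integral_cong) (auto simp: A_def indicator_def)
  have "emeasure N (A n) \<le> nn_integral disc_measure h" for n
    unfolding N by (intro nn_integral_mono) auto
  then have fin': "emeasure N (A n) \<noteq> \<infinity>" for n
    using fin by (metis infinity_ennreal_def not_le)
  have dec: "decseq A"
  proof (rule decseq_SucI)
    fix n
    have "inverse (real (Suc (Suc n))) \<le> inverse (real (Suc n))"
      by (intro le_imp_inverse_le) auto
    then show "A (Suc n) \<subseteq> A n"
      unfolding A_def by (intro Collect_mono) linarith
  qed
  have empty: "(\<Inter>n. A n) = {}"
  proof (rule ccontr)
    assume "(\<Inter>n. A n) \<noteq> {}"
    then obtain u where u: "\<And>n. u \<in> A n" by auto
    then have "0 < 1 - norm u"
      using u[of 0] by (simp add: A_def)
    then obtain n where "inverse (real (Suc n)) < 1 - norm u"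
      using reals_Archimedean by blast
    then show False
      using u[of n] by (simp add: A_def)
  qed
  have "(\<lambda>n. emeasure N (A n)) \<longlonglongrightarrow> emeasure N (\<Inter>n. A n)"
    using A dec fin' by (intro Lim_emeasure_decseq) (auto simp: N_def)
  then have "(\<lambda>n. emeasure N (A n)) \<longlonglongrightarrow> 0"
    by (simp add: empty)
  then have "eventually (\<lambda>n. emeasure N (A n) < ennreal \<delta>) sequentially"
    using \<delta> by (intro order_tendstoD(2)) auto
  \<comment> \<open>For n = 0 the inner radius would be 0, whereas \<open>R\<close> has to be
    positive.\<close>
  moreover have "eventually (\<lambda>n. 0 < n) sequentially"
    by (rule eventually_gt_at_top)
  ultimately have "eventually (\<lambda>n. emeasure N (A n) < ennreal \<delta> \<and> 0 < n) sequentially"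
    by (rule eventually_conj)
  then obtain n where n: "emeasure N (A n) < ennreal \<delta>" "0 < n"
    by (auto simp: eventually_sequentially)
  show thesis
  proof
    show "0 < 1 - inverse (real (Suc n))" "1 - inverse (real (Suc n)) < 1"
      using n by (auto simp: field_simps)
    show "(\<integral>\<^sup>+u. (if 1 - inverse (real (Suc n)) < norm u then h u else 0) \<partial>disc_measure) \<le> ennreal \<delta>"
      using n N by simp
  qed
qed

section \<open>Limits as |a| tends to 1, and their vanishing for univalent self-maps\<close>

lemma eventually_norm_at_left_1:
  "eventually P (filtercomap norm (at_left (1::real)))
    \<longleftrightarrow> (\<exists>\<rho><1. \<forall>a::complex. \<rho> < norm a \<and> norm a < 1 \<longrightarrow> P a)"
proof
  assume "eventually P (filtercomap norm (at_left (1::real)))"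
  then obtain Q where Q: "eventually Q (at_left (1::real))" "\<And>a. Q (norm a) \<Longrightarrow> P a"
    by (auto simp: eventually_filtercomap)
  then obtain \<rho> where "\<rho> < 1" "\<And>y. \<rho> < y \<Longrightarrow> y < 1 \<Longrightarrow> Q y"
    using eventually_at_left[of 0 "1::real" Q] by auto
  then show "\<exists>\<rho><1. \<forall>a::complex. \<rho> < norm a \<and> norm a < 1 \<longrightarrow> P a"
    using Q by blast
next
  assume "\<exists>\<rho><1. \<forall>a::complex. \<rho> < norm a \<and> norm a < 1 \<longrightarrow> P a"
  then obtain \<rho> where \<rho>: "\<rho> < 1" "\<And>a::complex. \<rho> < norm a \<Longrightarrow> norm a < 1 \<Longrightarrow> P a"
    by blast
  then have "eventually (\<lambda>y. \<rho> < y \<and> y < 1) (at_left (1::real))"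
    using eventually_at_left[of \<rho> 1] by blast
  then show "eventually P (filtercomap norm (at_left (1::real)))"
    unfolding eventually_filtercomap using \<rho> by blast
qed

lemma tendsto_0_norm_at_left_1_iff:
  fixes I :: "complex \<Rightarrow> ennreal"
  shows "(I \<longlongrightarrow> 0) (filtercomap norm (at_left (1::real)))
    \<longleftrightarrow> (\<forall>e>0. \<exists>\<rho><1. \<forall>a. \<rho> < norm a \<and> norm a < 1 \<longrightarrow> I a \<le> ennreal e)"
proof
  assume L: "(I \<longlongrightarrow> 0) (filtercomap norm (at_left (1::real)))"
  show "\<forall>e>0. \<exists>\<rho><1. \<forall>a. \<rho> < norm a \<and> norm a < 1 \<longrightarrow> I a \<le> ennreal e"
  proof (intro allI impI)
    fix e :: real assume "0 < e"
    then have "eventually (\<lambda>a. I a < ennreal e) (filtercomap norm (at_left (1::real)))"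
      using L by (intro order_tendstoD(2)) auto
    then show "\<exists>\<rho><1. \<forall>a. \<rho> < norm a \<and> norm a < 1 \<longrightarrow> I a \<le> ennreal e"
      unfolding eventually_norm_at_left_1 by (meson less_imp_le)
  qed
next
  assume R: "\<forall>e>0. \<exists>\<rho><1. \<forall>a. \<rho> < norm a \<and> norm a < 1 \<longrightarrow> I a \<le> ennreal e"
  show "(I \<longlongrightarrow> 0) (filtercomap norm (at_left (1::real)))"
  proof (rule order_tendstoI)
    fix y :: ennreal assume "0 < y"
    \<comment> \<open>As \<open>y\<close> may be infinite, a smaller value is interposed, which is
      then finite and hence a real.\<close>
    then obtain x where x: "0 < x" "x < y"
      using dense by blast
    then obtain e where e: "x = ennreal e" "0 \<le> e"
      by (cases x) (auto simp: top_unique)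
    with x have "0 < e" by simp
    then obtain \<rho> where \<rho>: "\<rho> < 1" "\<forall>a. \<rho> < norm a \<and> norm a < 1 \<longrightarrow> I a \<le> ennreal e"
      using R by blast
    then have "\<forall>a. \<rho> < norm a \<and> norm a < 1 \<longrightarrow> I a < y"
      using x e by (metis le_less_trans)
    then show "eventually (\<lambda>a. I a < y) (filtercomap norm (at_left (1::real)))"
      unfolding eventually_norm_at_left_1 using \<rho>(1) by blast
  qed simp
qed

text \<open>The disc is split at radius \<open>R\<close>. Inside, the weights are bounded and 1 -
  |\<phi>_a|^2 is of order 1 - |a|^2. Outside, the weight is split and Young's inequality with
  parameter \<eta> separates |\<psi>'|^2, whose tail is small, from |\<phi>_a'|^2, whose integral is
  at most 1 for every \<open>a\<close>.\<close>

lemma univalent_bmoa_integral_le: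
  assumes hol: "\<psi> holomorphic_on unit_disc" and sub: "\<psi> ` unit_disc \<subseteq> unit_disc"
    and inj: "inj_on \<psi> unit_disc" and p: "1 \<le> p" "p < 2"
    and \<eta>: "0 < \<eta>" "\<eta> \<le> 1" and R: "0 < R" "R < 1" and a: "norm a < 1"
  shows "bmoa_integral p \<psi> a \<le> ennreal (8 / (1 - R\<^sup>2)\<^sup>2 * (1 - (norm a)\<^sup>2))
    + ennreal (1 / \<eta>) * (\<integral>\<^sup>+z. (if R < norm z then ennreal ((norm (deriv \<psi> z))\<^sup>2) else 0) \<partial>disc_measure) + ennreal \<eta>"
proof -
  define K where "K = 4 / (1 - R\<^sup>2)\<^sup>2 * (1 - (norm a)\<^sup>2)"
  have R2: "0 < 1 - R\<^sup>2"
    using R by (simp add: abs_square_less_1)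
  have a2: "0 < 1 - (norm a)\<^sup>2"
    using norm_sq_less_one[OF a] by simp
  have K: "0 \<le> K"
    unfolding K_def using R2 a2 by simp
  note [measurable] = borel_measurable_disc_holomorphic[OF hol]
    borel_measurable_disc_holomorphic[OF holomorphic_on_disc_aut[OF a]]
  let ?D = "\<lambda>z. ennreal ((norm (deriv \<psi> z))\<^sup>2)"
  let ?G = "\<lambda>z. ennreal ((norm (deriv (disc_aut a) z))\<^sup>2)"
  let ?T = "\<lambda>z. if R < norm z then ?D z else 0"
  have pw: "ennreal (norm (deriv \<psi> z) powr p * (1 - (norm z)\<^sup>2) powr (p - 2) * (1 - (norm (disc_aut a z))\<^sup>2))
    \<le> ennreal K * (?D z + 1) + ennreal (1 / \<eta>) * ?T z + ennreal \<eta> * ?G z" if z: "norm z < 1" for z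
  proof -
    define x s g where "x = norm (deriv \<psi> z)" and "s = 1 - (norm z)\<^sup>2" and "g = norm (deriv (disc_aut a) z)"
    have s: "0 < s" "s \<le> 1" and x: "0 \<le> x"
      using norm_sq_less_one[OF z] by (auto simp: s_def x_def)
    have gs: "g * s = 1 - (norm (disc_aut a z))\<^sup>2"
      using norm_deriv_disc_aut[OF a z] by (simp add: g_def s_def)
    have gs0: "0 < g * s" "g * s \<le> 1"
      using norm_sq_less_one[OF norm_disc_aut_less_one[OF a z]] gs by auto
    then have g: "0 < g"
      using s by (simp add: zero_less_mult_iff)
    show ?thesis
    proof (cases "R < norm z")
      case False
      then have "(norm z)\<^sup>2 \<le> R\<^sup>2"
        by (intro power_mono) auto
      then have sR: "1 - R\<^sup>2 \<le> s"
        by (simp add: s_def)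
      have xp: "x powr p \<le> x\<^sup>2 + 1"
        using powr_mult_powr_le[of x 1 p] x p by simp
      have sp: "s powr (p - 2) \<le> 1 / (1 - R\<^sup>2)"
      proof -
        \<comment> \<open>Here p - 2 is at least -1 and \<open>s\<close> is at most 1.\<close>
        have "s powr (p - 2) \<le> s powr (-1)"
          using s p by (intro powr_mono') auto
        also have "\<dots> = 1 / s"
          using s by (simp add: powr_minus_divide)
        also have "\<dots> \<le> 1 / (1 - R\<^sup>2)"
          using sR R2 by (intro divide_left_mono mult_pos_pos) auto
        finally show ?thesis .
      qed
      have "g * s \<le> 4 * (1 - (norm a)\<^sup>2) / s"
        using one_minus_norm_disc_aut_sq_le[OF a z] unfolding gs by (simp add: s_def)
      also have "\<dots> \<le> 4 * (1 - (norm a)\<^sup>2) / (1 - R\<^sup>2)"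
        using sR R2 a2 s by (intro divide_left_mono mult_pos_pos) auto
      finally have "x powr p * s powr (p - 2) * (g * s) \<le> (x\<^sup>2 + 1) * (1 / (1 - R\<^sup>2)) * (4 * (1 - (norm a)\<^sup>2) / (1 - R\<^sup>2))"
        using xp sp gs0 R2 x by (intro mult_mono) auto
      also have "\<dots> = K * (x\<^sup>2 + 1)"
        by (simp add: K_def power2_eq_square)
      finally have "ennreal (x powr p * s powr (p - 2) * (g * s)) \<le> ennreal (K * (x\<^sup>2 + 1))"
        by (rule ennreal_leI)
      also have "\<dots> = ennreal K * (ennreal (x\<^sup>2) + 1)"
        using K by (simp add: ennreal_mult)
      also have "\<dots> \<le> ennreal K * (?D z + 1) + (ennreal (1 / \<eta>) * ?T z + ennreal \<eta> * ?G z)"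
        by (simp add: x_def)
      finally show ?thesis
        unfolding gs by (simp add: x_def s_def add.assoc)
    next
      case True
      have "s powr (p - 2) * (g * s) = (g * s) powr (p - 1) * g powr (2 - p)"
        by (rule powr_weight_split[OF g s(1)])
      also have "\<dots> \<le> 1 * g powr (2 - p)"
        using gs0 p by (intro mult_right_mono powr_le1) auto
      finally have "x powr p * (s powr (p - 2) * (g * s)) \<le> x powr p * g powr (2 - p)"
        by (intro mult_left_mono) auto
      \<comment> \<open>Rescaling \<open>g\<close> by \<eta> makes its share of Young's inequality
        small; the price \<eta>^(p-2) is at most 1/\<eta>.\<close>
      also have "\<dots> = \<eta> powr (p - 2) * (x powr p * (\<eta> * g) powr (2 - p))"
      proof -
        have "\<eta> powr (p - 2) * \<eta> powr (2 - p) = 1"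
          using \<eta> by (simp add: powr_add[symmetric])
        then show ?thesis
          by (simp add: powr_mult mult_ac)
      qed
      also have "\<dots> \<le> 1 / \<eta> * (x\<^sup>2 + (\<eta> * g)\<^sup>2)"
      proof (intro mult_mono powr_mult_powr_le)
        have "\<eta> powr (p - 2) \<le> \<eta> powr (-1)"
          using \<eta> p by (intro powr_mono') auto
        then show "\<eta> powr (p - 2) \<le> 1 / \<eta>"
          using \<eta> by (simp add: powr_minus_divide)
      qed (use \<eta> p g x in auto)
      also have "\<dots> = 1 / \<eta> * x\<^sup>2 + \<eta> * g\<^sup>2"
        using \<eta> by (simp add: field_simps power2_eq_square)
      finally have "ennreal (x powr p * (s powr (p - 2) * (g * s))) \<le> ennreal (1 / \<eta> * x\<^sup>2 + \<eta> * g\<^sup>2)"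
        by (rule ennreal_leI)
      also have "\<dots> = ennreal (1 / \<eta>) * ?T z + ennreal \<eta> * ?G z"
        using True \<eta> by (simp add: x_def g_def flip: ennreal_mult)
      also have "\<dots> \<le> ennreal K * (?D z + 1) + (ennreal (1 / \<eta>) * ?T z + ennreal \<eta> * ?G z)"
        by simp
      finally show ?thesis
        unfolding gs by (simp add: x_def s_def add.assoc mult.assoc)
    qed
  qed
  have "bmoa_integral p \<psi> a \<le> (\<integral>\<^sup>+z. ennreal K * (?D z + 1) + ennreal (1 / \<eta>) * ?T z + ennreal \<eta> * ?G z \<partial>disc_measure)"
    unfolding bmoa_integral_def by (intro nn_integral_mono pw) simp
  also have "\<dots> = ennreal K * ((\<integral>\<^sup>+z. ?D z \<partial>disc_measure) + 1) + ennreal (1 / \<eta>) * (\<integral>\<^sup>+z. ?T z \<partial>disc_measure)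
     + ennreal \<eta> * (\<integral>\<^sup>+z. ?G z \<partial>disc_measure)"
    by (simp add: nn_integral_add nn_integral_cmult)
  also have "\<dots> \<le> ennreal K * (1 + 1) + ennreal (1 / \<eta>) * (\<integral>\<^sup>+z. ?T z \<partial>disc_measure) + ennreal \<eta> * 1"
    using nn_integral_norm_deriv_sq_le[OF hol sub inj]
      nn_integral_norm_deriv_sq_le[OF holomorphic_on_disc_aut[OF a] disc_aut_image[OF a] inj_on_disc_aut[OF a]]
    by (intro add_mono mult_left_mono) auto
  also have "ennreal K * (1 + 1) = ennreal (8 / (1 - R\<^sup>2)\<^sup>2 * (1 - (norm a)\<^sup>2))"
  proof -
    have "ennreal K * (1 + 1) = ennreal (K * 2)"
      using K by (simp add: ennreal_mult)
    also have "K * 2 = 8 / (1 - R\<^sup>2)\<^sup>2 * (1 - (norm a)\<^sup>2)"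
      by (simp add: K_def)
    finally show ?thesis .
  qed
  finally show ?thesis by simp
qed

text \<open>The parameters are fixed in the order \<eta>, then \<open>R\<close>, then the radius for
  \<open>a\<close>, so that each of the three terms is at most e/3.\<close>

lemma univalent_bmoa_integral_tendsto_0:
  assumes hol: "\<psi> holomorphic_on unit_disc" and sub: "\<psi> ` unit_disc \<subseteq> unit_disc"
    and inj: "inj_on \<psi> unit_disc" and p: "1 \<le> p" "p < 2" and e: "0 < e"
  shows "\<exists>\<rho><1. \<forall>a. \<rho> < norm a \<and> norm a < 1 \<longrightarrow> bmoa_integral p \<psi> a \<le> ennreal e"
proof -
  define \<eta> where "\<eta> = min 1 (e / 3)"
  have \<eta>: "0 < \<eta>" "\<eta> \<le> 1" "\<eta> \<le> e / 3"
    using e by (auto simp: \<eta>_def)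
  let ?D = "\<lambda>z. ennreal ((norm (deriv \<psi> z))\<^sup>2)"
  have m: "?D \<in> borel_measurable disc_measure"
    using borel_measurable_disc_holomorphic(2)[OF hol] by measurable
  have "nn_integral disc_measure ?D < \<infinity>"
    using nn_integral_norm_deriv_sq_le[OF hol sub inj] by (simp add: le_less_trans)
  \<comment> \<open>The tail bound carries the factor \<eta> to cancel the coefficient
    1/\<eta>.\<close>
  moreover have "0 < \<eta> * e / 3"
    using \<eta> e by simp
  ultimately obtain R where R: "0 < R" "R < 1"
    "(\<integral>\<^sup>+z. (if R < norm z then ?D z else 0) \<partial>disc_measure) \<le> ennreal (\<eta> * e / 3)"
    using nn_integral_disc_tail[OF m] by metis
  have R2: "0 < 1 - R\<^sup>2"
    using R by (simp add: abs_square_less_1)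
  define L where "L = 8 / (1 - R\<^sup>2)\<^sup>2"
  have L: "0 < L" unfolding L_def using R2 by simp
  \<comment> \<open>Since 1 - |a|^2 is at most 2 (1 - |a|), this radius gives L (1 - |a|^2) at most
    e/3.\<close>
  define \<rho> where "\<rho> = 1 - e / (6 * L)"
  show ?thesis
  proof (intro exI[of _ \<rho>] conjI allI impI)
    show "\<rho> < 1"
      unfolding \<rho>_def using e L by simp
    fix a :: complex assume "\<rho> < norm a \<and> norm a < 1"
    then have a: "\<rho> < norm a" "norm a < 1" by auto
    have "1 - (norm a)\<^sup>2 = (1 - norm a) * (1 + norm a)"
      by (simp add: power2_eq_square algebra_simps)
    also have "\<dots> \<le> (1 - norm a) * 2"
      using a by (intro mult_left_mono) auto
    also have "\<dots> \<le> e / (6 * L) * 2"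
      using a by (simp add: \<rho>_def)
    finally have "L * (1 - (norm a)\<^sup>2) \<le> L * (e / (6 * L) * 2)"
      using L by (intro mult_left_mono) auto
    then have 1: "L * (1 - (norm a)\<^sup>2) \<le> e / 3"
      using L by simp
    have "bmoa_integral p \<psi> a \<le> ennreal (L * (1 - (norm a)\<^sup>2))
      + ennreal (1 / \<eta>) * (\<integral>\<^sup>+z. (if R < norm z then ?D z else 0) \<partial>disc_measure) + ennreal \<eta>"
      unfolding L_def by (rule univalent_bmoa_integral_le[OF hol sub inj p \<eta>(1,2) R(1,2) a(2)])
    also have "\<dots> \<le> ennreal (e / 3) + ennreal (1 / \<eta>) * ennreal (\<eta> * e / 3) + ennreal (e / 3)"
      using 1 R(3) \<eta> by (intro add_mono mult_left_mono ennreal_leI) auto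
    also have "ennreal (1 / \<eta>) * ennreal (\<eta> * e / 3) = ennreal (e / 3)"
      using \<eta> e by (subst ennreal_mult[symmetric]) auto
    also have "ennreal (e / 3) + ennreal (e / 3) + ennreal (e / 3) = ennreal e"
      using e by (simp flip: ennreal_plus)
    finally show "bmoa_integral p \<psi> a \<le> ennreal e" .
  qed
qed

text \<open>For \<open>u\<close> in a compact set, 1 - |\<phi>_u(\<psi>(z))|^2 is at most a constant
  times 1 - |\<psi>(z)|^2. Its fifth power outweighs (1 - |\<psi>(z)|^2)^(-p), and the integrand of
  \<open>bmoa_integral p \<psi> a\<close> remains.\<close>

lemma nn_integral_comp_kernel_le_interior:
  assumes hol: "\<psi> holomorphic_on unit_disc" and sub: "\<psi> ` unit_disc \<subseteq> unit_disc"
    and u: "norm u \<le> R" and R: "0 < R" "R < 1" and a: "norm a < 1" and p: "1 \<le> p" "p < 2"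
  shows "(\<integral>\<^sup>+z. ennreal (comp_kernel p \<psi> a u z) \<partial>disc_measure)
    \<le> ennreal ((4 / (1 - R\<^sup>2)) ^ 5) * bmoa_integral p \<psi> a"
proof -
  have R2: "0 < 1 - R\<^sup>2"
    using R by (simp add: abs_square_less_1)
  have u1: "norm u < 1" using u R by simp
  have "(norm u)\<^sup>2 \<le> R\<^sup>2"
    using u by (intro power_mono) auto
  then have uR: "1 - R\<^sup>2 \<le> 1 - (norm u)\<^sup>2" by simp
  note [measurable] = borel_measurable_disc_holomorphic[OF hol]
    borel_measurable_disc_holomorphic[OF holomorphic_on_disc_aut[OF a]]
  have "(\<integral>\<^sup>+z. ennreal (comp_kernel p \<psi> a u z) \<partial>disc_measure)
    \<le> (\<integral>\<^sup>+z. ennreal ((4 / (1 - R\<^sup>2)) ^ 5) * ennreal (norm (deriv \<psi> z) powr p * (1 - (norm z)\<^sup>2) powr (p - 2)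
                    * (1 - (norm (disc_aut a z))\<^sup>2)) \<partial>disc_measure)"
  proof (rule nn_integral_mono)
    fix z assume "z \<in> space disc_measure"
    then have z: "norm z < 1" by simp
    have \<psi>z: "norm (\<psi> z) < 1"
      using sub z by (simp add: image_subset_iff)
    define r where "r = 1 - (norm (\<psi> z))\<^sup>2"
    define V where "V = norm (deriv \<psi> z) powr p * (1 - (norm z)\<^sup>2) powr (p - 2) * (1 - (norm (disc_aut a z))\<^sup>2)"
    have r: "0 < r" "r \<le> 1"
      using norm_sq_less_one[OF \<psi>z] by (auto simp: r_def)
    have V: "0 \<le> V"
      using norm_sq_less_one[OF norm_disc_aut_less_one[OF a z]] by (simp add: V_def)
    define k where "k = 1 - (norm (disc_aut u (\<psi> z)))\<^sup>2"
    have k: "0 < k"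
      using norm_sq_less_one[OF norm_disc_aut_less_one[OF u1 \<psi>z]] by (simp add: k_def)
    have "k \<le> 4 * r / (1 - (norm u)\<^sup>2)"
      using one_minus_norm_disc_aut_sq_le[OF \<psi>z u1]
      by (simp add: k_def r_def norm_disc_aut_commute[of u])
    also have "\<dots> \<le> 4 * r / (1 - R\<^sup>2)"
      using uR R2 r by (intro divide_left_mono mult_pos_pos) auto
    finally have "k ^ 5 \<le> (4 * r / (1 - R\<^sup>2)) ^ 5"
      using k by (intro power_mono) auto
    also have "\<dots> = (4 / (1 - R\<^sup>2)) ^ 5 * r ^ 5"
      by (simp add: power_mult_distrib power_divide)
    finally have "r powr (- p) * k ^ 5 \<le> r powr (- p) * ((4 / (1 - R\<^sup>2)) ^ 5 * r ^ 5)"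
      by (intro mult_left_mono) auto
    also have "\<dots> = (4 / (1 - R\<^sup>2)) ^ 5 * (r powr (- p) * r powr 5)"
      using r by (simp add: powr_numeral)
    also have "r powr (- p) * r powr 5 = r powr (5 - p)"
      by (simp add: powr_add[symmetric])
    also have "(4 / (1 - R\<^sup>2)) ^ 5 * r powr (5 - p) \<le> (4 / (1 - R\<^sup>2)) ^ 5 * 1"
      using r p R2 by (intro mult_left_mono powr_le1) auto
    finally have "V * (r powr (- p) * k ^ 5) \<le> V * ((4 / (1 - R\<^sup>2)) ^ 5 * 1)"
      using V by (intro mult_left_mono)
    then have "comp_kernel p \<psi> a u z \<le> (4 / (1 - R\<^sup>2)) ^ 5 * V"
      by (simp add: comp_kernel_def V_def r_def k_def mult_ac)
    then have "ennreal (comp_kernel p \<psi> a u z) \<le> ennreal ((4 / (1 - R\<^sup>2)) ^ 5 * V)"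
      by (rule ennreal_leI)
    also have "\<dots> = ennreal ((4 / (1 - R\<^sup>2)) ^ 5) * ennreal V"
      using V by (rule ennreal_mult'')
    finally show "ennreal (comp_kernel p \<psi> a u z) \<le> ennreal ((4 / (1 - R\<^sup>2)) ^ 5) * ennreal (norm (deriv \<psi> z) powr p * (1 - (norm z)\<^sup>2) powr (p - 2)
                    * (1 - (norm (disc_aut a z))\<^sup>2))"
      by (simp add: V_def)
  qed
  also have "\<dots> = ennreal ((4 / (1 - R\<^sup>2)) ^ 5) * bmoa_integral p \<psi> a"
    unfolding bmoa_integral_def by (rule nn_integral_cmult) measurable
  finally show ?thesis .
qed

text \<open>Treats points \<open>a\<close> whose image stays away from the circle. For |u| > R the
  kernel bound is a multiple of 1 - |u|^2 because |\<psi>(a)| is at most \<rho>. For |u| up to R the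
  interior bound applies, and a factor (1 - |u|^2) / (1 - R^2), at least 1, is inserted to restore
  the integrand of \<open>bmoa_integral p f 0\<close>.\<close>

lemma bmoa_integral_comp_split:
  assumes f: "f holomorphic_on unit_disc"
    and hol: "\<psi> holomorphic_on unit_disc" and sub: "\<psi> ` unit_disc \<subseteq> unit_disc" and inj: "inj_on \<psi> unit_disc"
    and a: "norm a < 1" and p: "1 \<le> p" "p < 2" and R: "0 < R" "R < 1" and \<rho>: "norm (\<psi> a) \<le> \<rho>" "\<rho> < 1"
  shows "bmoa_integral p (f \<circ> \<psi>) a \<le> ennreal (8000000 / (1 - \<rho>\<^sup>2)) * (\<integral>\<^sup>+u. (if R < norm u then
       ennreal (norm (deriv f u) powr p * (1 - (norm u)\<^sup>2) powr (p - 2) * (1 - (norm u)\<^sup>2)) else 0) \<partial>disc_measure)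
    + ennreal (20 * (4 / (1 - R\<^sup>2)) ^ 5 / (1 - R\<^sup>2)) * bmoa_integral p \<psi> a * bmoa_integral p f 0"
proof -
  define E where "E = (\<lambda>u. norm (deriv f u) powr p * (1 - (norm u)\<^sup>2) powr (p - 2))"
  define \<kappa> where "\<kappa> = (\<lambda>u. \<integral>\<^sup>+z. ennreal (comp_kernel p \<psi> a u z) \<partial>disc_measure)"
  define J where "J = bmoa_integral p \<psi> a"
  define M where "M = 400000 / (1 - \<rho>\<^sup>2)"
  define Q where "Q = (4 / (1 - R\<^sup>2)) ^ 5"
  let ?t = "\<lambda>u. if R < norm u then ennreal (E u * (1 - (norm u)\<^sup>2)) else 0"
  have R2: "0 < 1 - R\<^sup>2"
    using R by (simp add: abs_square_less_1)
  have \<psi>a: "norm (\<psi> a) < 1" "0 \<le> \<rho>"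
    using \<rho> norm_ge_zero[of "\<psi> a"] by linarith+
  have \<rho>2: "0 < 1 - \<rho>\<^sup>2"
    using \<rho> \<psi>a by (simp add: abs_square_less_1)
  have M: "0 < M" and Q: "0 < Q"
    using \<rho>2 R2 by (auto simp: M_def Q_def)
  have E0: "0 \<le> E u" for u by (simp add: E_def)
  note [measurable] = borel_measurable_disc_holomorphic[OF f]
  have Em [measurable]: "E \<in> borel_measurable disc_measure"
    unfolding E_def by measurable
  have I0: "bmoa_integral p f 0 = (\<integral>\<^sup>+u. ennreal (E u * (1 - (norm u)\<^sup>2)) \<partial>disc_measure)"
    by (simp add: bmoa_integral_def E_def disc_aut_zero_left)
  have pw: "ennreal (E u) * \<kappa> u \<le> ennreal M * ?t u + (ennreal (Q / (1 - R\<^sup>2)) * J) * ennreal (E u * (1 - (norm u)\<^sup>2))"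
    if u: "norm u < 1" for u
  proof (cases "R < norm u")
    case True
    define s where "s = 1 - (norm u)\<^sup>2"
    have s: "0 < s" using norm_sq_less_one[OF u] by (simp add: s_def)
    have "1 - (norm (disc_aut (\<psi> a) u))\<^sup>2 \<le> 4 * s / (1 - (norm (\<psi> a))\<^sup>2)"
      using one_minus_norm_disc_aut_sq_le[OF u \<psi>a(1)] by (simp add: s_def norm_disc_aut_commute[of u])
    also have "\<dots> \<le> 4 * s / (1 - \<rho>\<^sup>2)"
      using \<rho> \<rho>2 s power_mono[OF \<rho>(1), of 2] by (intro divide_left_mono mult_pos_pos) auto
    finally have "100000 * (1 - (norm (disc_aut (\<psi> a) u))\<^sup>2) \<le> M * s"
      by (simp add: M_def)
    then have "\<kappa> u \<le> ennreal (M * s)"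
      unfolding \<kappa>_def using nn_integral_comp_kernel_le[OF hol sub inj u a p] by (meson ennreal_leI order_trans)
    then have "ennreal (E u) * \<kappa> u \<le> ennreal (E u) * ennreal (M * s)"
      by (intro mult_left_mono) auto
    also have "\<dots> = ennreal M * ennreal (E u * s)"
      using M s E0[of u] by (simp add: ennreal_mult mult_ac)
    finally show ?thesis
      using True by (simp add: s_def add_increasing2)
  next
    case False
    then have "(norm u)\<^sup>2 \<le> R\<^sup>2"
      by (intro power_mono) auto
    then have "E u * (1 - R\<^sup>2) \<le> E u * (1 - (norm u)\<^sup>2)"
      using E0 by (intro mult_left_mono) auto
    then have "E u \<le> 1 / (1 - R\<^sup>2) * (E u * (1 - (norm u)\<^sup>2))"
      using R2 by (simp add: field_simps)
    then have "ennreal (E u) * \<kappa> u \<le> ennreal (1 / (1 - R\<^sup>2) * (E u * (1 - (norm u)\<^sup>2))) * (ennreal Q * J)"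
      unfolding \<kappa>_def J_def Q_def using False
      by (intro mult_mono ennreal_leI nn_integral_comp_kernel_le_interior[OF hol sub _ R a p]) auto
    also have "\<dots> = (ennreal (1 / (1 - R\<^sup>2)) * ennreal Q) * J * ennreal (E u * (1 - (norm u)\<^sup>2))"
      using R2 by (subst ennreal_mult') (auto simp: mult_ac)
    also have "ennreal (1 / (1 - R\<^sup>2)) * ennreal Q = ennreal (Q / (1 - R\<^sup>2))"
      using R2 Q by (subst ennreal_mult[symmetric]) auto
    finally show ?thesis
      using False by simp
  qed
  have "bmoa_integral p (f \<circ> \<psi>) a \<le> 20 * (\<integral>\<^sup>+u. ennreal (E u) * \<kappa> u \<partial>disc_measure)"
    unfolding E_def \<kappa>_def by (rule bmoa_integral_comp_le_kernel[OF f hol sub a p])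
  also have "\<dots> \<le> 20 * (\<integral>\<^sup>+u. ennreal M * ?t u + (ennreal (Q / (1 - R\<^sup>2)) * J) * ennreal (E u * (1 - (norm u)\<^sup>2)) \<partial>disc_measure)"
    by (intro mult_left_mono nn_integral_mono pw) auto
  also have "\<dots> = 20 * (ennreal M * (\<integral>\<^sup>+u. ?t u \<partial>disc_measure) + (ennreal (Q / (1 - R\<^sup>2)) * J) * bmoa_integral p f 0)"
    unfolding I0 by (simp add: nn_integral_add nn_integral_cmult)
  also have "\<dots> = (20 * ennreal M) * (\<integral>\<^sup>+u. ?t u \<partial>disc_measure) + (20 * ennreal (Q / (1 - R\<^sup>2))) * J * bmoa_integral p f 0"
    by (simp add: distrib_left mult.assoc)
  also have "20 * ennreal M = ennreal (8000000 / (1 - \<rho>\<^sup>2))"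
  proof -
    have "20 * ennreal M = ennreal (20 * M)"
      using M by (simp add: ennreal_mult)
    then show ?thesis by (simp add: M_def)
  qed
  also have "20 * ennreal (Q / (1 - R\<^sup>2)) = ennreal (20 * Q / (1 - R\<^sup>2))"
  proof -
    have "20 * ennreal (Q / (1 - R\<^sup>2)) = ennreal (20 * (Q / (1 - R\<^sup>2)))"
      using Q R2 by (subst ennreal_mult) auto
    then show ?thesis by simp
  qed
  finally show ?thesis
    unfolding E_def J_def Q_def .
qed

text \<open>The radius \<rho> comes from the decay of \<open>f\<close> and separates the two cases
  for |\<psi>(a)|. Then \<open>R\<close> is chosen from \<rho> to make the tail small, and the final
  radius from \<open>R\<close> by the decay for \<psi> itself.\<close>

lemma VMOA_comp_tendsto:
  assumes f: "f \<in> VMOA p"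
    and hol: "\<psi> holomorphic_on unit_disc" and sub: "\<psi> ` unit_disc \<subseteq> unit_disc" and inj: "inj_on \<psi> unit_disc"
    and p: "1 \<le> p" "p < 2"
  shows "(bmoa_integral p (f \<circ> \<psi>) \<longlongrightarrow> 0) (filtercomap norm (at_left 1))"
  unfolding tendsto_0_norm_at_left_1_iff
proof (intro allI impI)
  fix e :: real assume e: "0 < e"
  have fh: "f holomorphic_on unit_disc" and fs: "bmoa_sup p f < \<infinity>"
    and ft: "(bmoa_integral p f \<longlongrightarrow> 0) (filtercomap norm (at_left 1))"
    using f by (auto simp: VMOA_def BMOA_def)
  have "0 < e / 2000000" using e by simp
  then obtain \<rho>1 where \<rho>1: "\<rho>1 < 1" "\<And>b. \<rho>1 < norm b \<Longrightarrow> norm b < 1 \<Longrightarrow> bmoa_integral p f b \<le> ennreal (e / 2000000)"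
    using ft unfolding tendsto_0_norm_at_left_1_iff by blast
  \<comment> \<open>The radius is made nonnegative so that 1 - \<rho>^2 is positive.\<close>
  define \<rho> where "\<rho> = max 0 \<rho>1"
  have \<rho>: "0 \<le> \<rho>" "\<rho> < 1" "\<rho>1 \<le> \<rho>"
    using \<rho>1 by (auto simp: \<rho>_def)
  have \<rho>2: "0 < 1 - \<rho>\<^sup>2"
    using \<rho> by (simp add: abs_square_less_1)
  have "bmoa_integral p f 0 \<le> bmoa_sup p f"
    unfolding bmoa_sup_def by (rule SUP_upper) simp
  then have I0: "bmoa_integral p f 0 < \<infinity>"
    using fs by (rule le_less_trans)
  define h where "h = (\<lambda>u. ennreal (norm (deriv f u) powr p * (1 - (norm u)\<^sup>2) powr (p - 2) * (1 - (norm u)\<^sup>2)))"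
  have hI: "bmoa_integral p f 0 = nn_integral disc_measure h"
    by (simp add: bmoa_integral_def h_def disc_aut_zero_left)
  note [measurable] = borel_measurable_disc_holomorphic[OF fh]
  have hm: "h \<in> borel_measurable disc_measure"
    unfolding h_def by measurable
  define M where "M = 8000000 / (1 - \<rho>\<^sup>2)"
  have M: "0 < M" using \<rho>2 by (simp add: M_def)
  have "0 < e / (2 * M)" using e M by simp
  then obtain R where R: "0 < R" "R < 1" "(\<integral>\<^sup>+u. (if R < norm u then h u else 0) \<partial>disc_measure) \<le> ennreal (e / (2 * M))"
    using nn_integral_disc_tail[OF hm] I0 unfolding hI by metis
  have R2: "0 < 1 - R\<^sup>2"
    using R by (simp add: abs_square_less_1)
  define Q where "Q = 20 * (4 / (1 - R\<^sup>2)) ^ 5 / (1 - R\<^sup>2)"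
  have Q: "0 < Q" using R2 by (simp add: Q_def)
  define i where "i = enn2real (bmoa_integral p f 0)"
  have i: "bmoa_integral p f 0 = ennreal i" "0 \<le> i"
    using I0 by (auto simp: i_def)
  \<comment> \<open>The summand 1 avoids division by zero when \<open>i\<close> is 0.\<close>
  have "0 < e / (2 * Q * (i + 1))"
    using e Q i by simp
  then obtain \<rho>3 where \<rho>3: "\<rho>3 < 1" "\<And>a. \<rho>3 < norm a \<Longrightarrow> norm a < 1 \<Longrightarrow> bmoa_integral p \<psi> a \<le> ennreal (e / (2 * Q * (i + 1)))"
    using univalent_bmoa_integral_tendsto_0[OF hol sub inj p] by meson
  show "\<exists>\<rho><1. \<forall>a. \<rho> < norm a \<and> norm a < 1 \<longrightarrow> bmoa_integral p (f \<circ> \<psi>) a \<le> ennreal e"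
  proof (intro exI[of _ \<rho>3] conjI allI impI \<rho>3(1))
    fix a :: complex assume "\<rho>3 < norm a \<and> norm a < 1"
    then have a: "\<rho>3 < norm a" "norm a < 1" by auto
    have \<psi>a: "norm (\<psi> a) < 1"
      using sub a by (simp add: image_subset_iff)
    show "bmoa_integral p (f \<circ> \<psi>) a \<le> ennreal e"
    proof (cases "norm (\<psi> a) \<le> \<rho>")
      case False
      then have "bmoa_integral p f (\<psi> a) \<le> ennreal (e / 2000000)"
        using \<rho> \<psi>a by (intro \<rho>1) auto
      then have "2000000 * bmoa_integral p f (\<psi> a) \<le> ennreal 2000000 * ennreal (e / 2000000)"
        by (simp add: mult_left_mono)
      also have "\<dots> = ennreal e"
        using e by (subst ennreal_mult[symmetric]) auto
      finally show ?thesis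
        using bmoa_integral_comp_le[OF fh hol sub inj a(2) p] by (rule order_trans[rotated])
    next
      case True
      have "bmoa_integral p (f \<circ> \<psi>) a \<le> ennreal M * (\<integral>\<^sup>+u. (if R < norm u then h u else 0) \<partial>disc_measure)
        + ennreal Q * bmoa_integral p \<psi> a * bmoa_integral p f 0"
        unfolding M_def Q_def h_def
        by (rule bmoa_integral_comp_split[OF fh hol sub inj a(2) p R(1,2) True \<rho>(2)])
      also have "\<dots> \<le> ennreal M * ennreal (e / (2 * M)) + ennreal Q * ennreal (e / (2 * Q * (i + 1))) * ennreal i"
        unfolding i(1) using R(3) \<rho>3(2)[OF a] by (intro add_mono mult_left_mono mult_right_mono) auto
      also have "\<dots> = ennreal (M * (e / (2 * M)) + Q * (e / (2 * Q * (i + 1))) * i)"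
        using M Q e i by (simp flip: ennreal_mult ennreal_plus)
      also have "\<dots> \<le> ennreal e"
      proof (rule ennreal_leI)
        have "Q * (e / (2 * Q * (i + 1))) * i = e / 2 * (i / (i + 1))"
          using Q by simp
        also have "\<dots> \<le> e / 2 * 1"
          using i e by (intro mult_left_mono) auto
        finally show "M * (e / (2 * M)) + Q * (e / (2 * Q * (i + 1))) * i \<le> e"
          using M by simp
      qed
      finally show ?thesis .
    qed
  qed
qed

section \<open>Growth and norm estimates\<close>

text \<open>Inclusion in the Bloch space. In \<open>norm_deriv_powr_le\<close> the fifth power of 1
  - |\<phi>_w|^2 is at most the first power, which gives the integral at the base point
  \<open>w\<close>.\<close>

lemma norm_deriv_le_bmoa_sup:
  assumes f: "f \<in> BMOA p" and w: "norm w < 1" and p: "1 \<le> p" "p < 2"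
  shows "norm (deriv f w) * (1 - (norm w)\<^sup>2) \<le> 20 * enn2real (bmoa_sup p f) powr (1 / p)"
proof -
  have hol: "f holomorphic_on unit_disc" and fin: "bmoa_sup p f < \<infinity>"
    using f by (auto simp: BMOA_def)
  define s where "s = enn2real (bmoa_sup p f)"
  define x where "x = norm (deriv f w) * (1 - (norm w)\<^sup>2)"
  have s: "bmoa_sup p f = ennreal s" "0 \<le> s"
    using fin by (auto simp: s_def)
  have x: "0 \<le> x"
    using norm_sq_less_one[OF w] by (simp add: x_def)
  have "ennreal (x powr p) \<le> 20 * (\<integral>\<^sup>+u. ennreal (norm (deriv f u) powr p * (1 - (norm u)\<^sup>2) powr (p - 2)
            * (1 - (norm (disc_aut w u))\<^sup>2) ^ 5) \<partial>disc_measure)"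
    unfolding x_def using p by (intro norm_deriv_powr_le hol w) auto
  also have "\<dots> \<le> 20 * bmoa_integral p f w"
    unfolding bmoa_integral_def
  proof (intro mult_left_mono nn_integral_mono ennreal_leI)
    fix u assume "u \<in> space disc_measure"
    then have "norm (disc_aut w u) < 1"
      using w by (intro norm_disc_aut_less_one) auto
    then show "(1 - (norm (disc_aut w u))\<^sup>2) ^ 5 \<le> 1 - (norm (disc_aut w u))\<^sup>2"
      using norm_sq_less_one[of "disc_aut w u"] power_decreasing[of 1 5 "1 - (norm (disc_aut w u))\<^sup>2"] by simp
  qed auto
  also have "\<dots> \<le> 20 * bmoa_sup p f"
    unfolding bmoa_sup_def using w by (intro mult_left_mono SUP_upper) auto
  also have "\<dots> = ennreal (20 * s)"
    using s by (simp add: ennreal_mult)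
  finally have "x powr p \<le> 20 * s"
    using s by (subst (asm) ennreal_le_iff) auto
  then have "(x powr p) powr (1 / p) \<le> (20 * s) powr (1 / p)"
    using p by (intro powr_mono2) auto
  also have "\<dots> = 20 powr (1 / p) * s powr (1 / p)"
    by (simp add: powr_mult)
  also have "\<dots> \<le> 20 powr 1 * s powr (1 / p)"
    using p by (intro mult_right_mono powr_mono) auto
  finally show ?thesis
    using x p by (simp add: powr_powr x_def s_def)
qed

text \<open>Integration along the radius to \<open>b\<close>: the derivative bound is K times the
  hyperbolic density, whose antiderivative is the logarithm. This is the source of the logarithm in
  the theorem.\<close>

lemma Bloch_growth:
  assumes hol: "f holomorphic_on unit_disc" and K: "\<And>w. norm w < 1 \<Longrightarrow> norm (deriv f w) * (1 - (norm w)\<^sup>2) \<le> K"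
    and b: "norm b < 1"
  shows "norm (f b - f 0) \<le> K / 2 * ln ((1 + norm b) / (1 - norm b))"
proof -
  define \<phi> where "\<phi> = (\<lambda>t. K / 2 * (ln (1 + t * norm b) - ln (1 - t * norm b)))"
  define \<phi>' where "\<phi>' = (\<lambda>t. K * norm b / (1 - (t * norm b)\<^sup>2))"
  have tb: "t * norm b < 1" "0 \<le> t * norm b" if "0 \<le> t" "t \<le> 1" for t
    using that b mult_left_le_one_le[of "norm b" t] by auto
  have df: "((\<lambda>t. f (of_real t * b)) has_vector_derivative (b * deriv f (of_real t * b))) (at t)" if "0 \<le> t" "t \<le> 1" for t
  proof -
    have "(f has_field_derivative deriv f (of_real t * b)) (at (of_real t * b))"
      using hol tb[OF that] that by (auto intro!: holomorphic_derivI simp: norm_mult)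
    moreover have "((\<lambda>t. of_real t * b) has_vector_derivative b) (at t)"
      by (auto intro!: derivative_eq_intros)
    ultimately show ?thesis
      using field_vector_diff_chain_at[of "\<lambda>t. of_real t * b" b t f "deriv f (of_real t * b)"]
      by (auto simp: comp_def)
  qed
  have d\<phi>: "(\<phi> has_vector_derivative \<phi>' t) (at t)" if "0 \<le> t" "t \<le> 1" for t
  proof -
    define y where "y = t * norm b"
    have y: "0 \<le> y" "y < 1" using tb[OF that] by (auto simp: y_def)
    have "(\<phi> has_real_derivative (K / 2 * (norm b / (1 + t * norm b) - (- norm b) / (1 - t * norm b)))) (at t)"
      unfolding \<phi>_def using tb[OF that] by (auto intro!: derivative_eq_intros)
    moreover have "K / 2 * (norm b / (1 + y) - (- norm b) / (1 - y)) = K * norm b / (1 - y\<^sup>2)"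
    proof -
      have "1 - y\<^sup>2 = (1 + y) * (1 - y)" by (simp add: power2_eq_square algebra_simps)
      then show ?thesis using y by (simp add: field_simps)
    qed
    ultimately have "(\<phi> has_real_derivative K * norm b / (1 - (t * norm b)\<^sup>2)) (at t)"
      unfolding y_def by (simp only:)
    then show ?thesis
      by (simp only: \<phi>'_def has_real_derivative_iff_has_vector_derivative)
  qed
  have "norm ((\<lambda>t. f (of_real t * b)) 1 - (\<lambda>t. f (of_real t * b)) 0) \<le> \<phi> 1 - \<phi> 0"
  proof (rule differentiable_bound_general[where f' = "\<lambda>t. b * deriv f (of_real t * b)" and \<phi>' = \<phi>'])
    show "continuous_on {0..1} (\<lambda>t. f (of_real t * b))" "continuous_on {0..1} \<phi>"
      using df d\<phi> by (auto intro!: continuous_at_imp_continuous_on has_vector_derivative_continuous)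
    fix t :: real assume t: "0 < t" "t < 1"
    have "norm (deriv f (of_real t * b)) * (1 - (t * norm b)\<^sup>2) \<le> K"
      using K[of "of_real t * b"] tb[of t] t by (simp add: norm_mult)
    moreover have "0 < 1 - (t * norm b)\<^sup>2"
      using tb[of t] t by (simp add: abs_square_less_1)
    ultimately have "norm (deriv f (of_real t * b)) \<le> K / (1 - (t * norm b)\<^sup>2)"
      by (simp add: field_simps)
    then have "norm b * norm (deriv f (of_real t * b)) \<le> norm b * (K / (1 - (t * norm b)\<^sup>2))"
      by (intro mult_left_mono) auto
    then show "norm (b * deriv f (of_real t * b)) \<le> \<phi>' t"
      by (simp add: norm_mult \<phi>'_def mult_ac)
  qed (use df d\<phi> in auto)
  moreover have "ln ((1 + norm b) / (1 - norm b)) = ln (1 + norm b) - ln (1 - norm b)"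
    using b by (intro ln_divide_pos) (auto intro: add_pos_nonneg)
  ultimately show ?thesis
    by (simp add: \<phi>_def)
qed

text \<open>The l^p norm of a pair is at most its l^1 norm. With total x + z, each ratio t / (x + z)
  lies between 0 and 1 and does not increase when raised to the power \<open>p\<close>.\<close>

lemma powr_root_add_le:
  fixes x y p :: real
  assumes "0 \<le> x" "0 \<le> y" "1 \<le> p"
  shows "(x powr p + y) powr (1 / p) \<le> x + y powr (1 / p)"
proof -
  define z where "z = y powr (1 / p)"
  have y: "y = z powr p" and z: "0 \<le> z"
    using assms by (auto simp: z_def powr_powr)
  have "x powr p + z powr p \<le> (x + z) powr p"
  proof (cases "x + z = 0")
    case True
    then have "x = 0" "z = 0" using assms z by auto
    then show ?thesis by simp
  next
    case False
    then have s: "0 < x + z" using assms z by simp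
    have le: "t powr p \<le> (x + z) powr p * (t / (x + z))" if "0 \<le> t" "t \<le> x + z" for t
    proof -
      have "(t / (x + z)) powr p \<le> (t / (x + z)) powr 1"
        using that s assms by (intro powr_mono') auto
      then have "(t / (x + z)) powr p \<le> t / (x + z)"
        using that s by simp
      then have "(x + z) powr p * (t / (x + z)) powr p \<le> (x + z) powr p * (t / (x + z))"
        by (intro mult_left_mono) auto
      moreover have "(x + z) powr p * (t / (x + z)) powr p = t powr p"
        using s by (simp add: powr_divide)
      ultimately show ?thesis by simp
    qed
    have "x powr p + z powr p \<le> (x + z) powr p * (x / (x + z)) + (x + z) powr p * (z / (x + z))"
      using assms z by (intro add_mono le) auto
    also have "\<dots> = (x + z) powr p * ((x + z) / (x + z))"
      by (simp only: distrib_left add_divide_distrib)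
    also have "\<dots> = (x + z) powr p"
      using s by simp
    finally show ?thesis .
  qed
  then have "(x powr p + y) powr (1 / p) \<le> ((x + z) powr p) powr (1 / p)"
    unfolding y using assms by (intro powr_mono2) auto
  also have "\<dots> = x + z"
    using assms z by (simp add: powr_powr)
  finally show ?thesis by (simp add: z_def)
qed

section \<open>Bounds for the composition operator in the seminorm and in the norm\<close>

lemma bmoa_sup_comp_le:
  assumes f: "f \<in> BMOA p"
    and hol: "\<psi> holomorphic_on unit_disc" and sub: "\<psi> ` unit_disc \<subseteq> unit_disc" and inj: "inj_on \<psi> unit_disc"
    and p: "1 \<le> p" "p < 2"
  shows "bmoa_sup p (f \<circ> \<psi>) \<le> 2000000 * bmoa_sup p f"
  unfolding bmoa_sup_def[of p "f \<circ> \<psi>"]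
proof (rule SUP_least)
  fix a :: complex assume "a \<in> unit_disc"
  then have a: "norm a < 1" by simp
  have "bmoa_integral p (f \<circ> \<psi>) a \<le> 2000000 * bmoa_integral p f (\<psi> a)"
    using f by (intro bmoa_integral_comp_le hol sub inj a p) (simp add: BMOA_def)
  also have "\<dots> \<le> 2000000 * bmoa_sup p f"
    unfolding bmoa_sup_def using sub a by (intro mult_left_mono SUP_upper) (auto simp: image_subset_iff)
  finally show "bmoa_integral p (f \<circ> \<psi>) a \<le> 2000000 * bmoa_sup p f" .
qed

lemma BMOA_comp:
  assumes f: "f \<in> BMOA p"
    and hol: "\<psi> holomorphic_on unit_disc" and sub: "\<psi> ` unit_disc \<subseteq> unit_disc" and inj: "inj_on \<psi> unit_disc"
    and p: "1 \<le> p" "p < 2"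
  shows "f \<circ> \<psi> \<in> BMOA p"
proof -
  have "(f \<circ> \<psi>) holomorphic_on unit_disc"
    using f holomorphic_on_compose_gen[OF hol _ sub] by (simp add: BMOA_def)
  moreover have "2000000 * bmoa_sup p f < \<infinity>"
    using f by (auto simp: BMOA_def ennreal_mult_less_top less_top)
  ultimately show ?thesis
    using bmoa_sup_comp_le[OF assms] by (auto simp: BMOA_def)
qed

text \<open>The supremum part of the norm grows only by a constant. The value at 0 becomes
  f(\<psi>(0)), and its distance from f(0) is controlled by \<open>Bloch_growth\<close> with K = 20
  s^(1/p). Bounding roots such as 2000000^(1/p) by their bases makes the final constant uniform in
  \<open>p\<close>.\<close>

lemma bmoa_norm_comp_le:
  assumes f: "f \<in> BMOA p"
    and hol: "\<psi> holomorphic_on unit_disc" and sub: "\<psi> ` unit_disc \<subseteq> unit_disc" and inj: "inj_on \<psi> unit_disc"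
    and p: "1 \<le> p" "p < 2"
  shows "bmoa_norm p (f \<circ> \<psi>) \<le> 3000000 * (1 + ln ((1 + norm (\<psi> 0)) / (1 - norm (\<psi> 0)))) * bmoa_norm p f"
proof -
  define L where "L = ln ((1 + norm (\<psi> 0)) / (1 - norm (\<psi> 0)))"
  define s where "s = enn2real (bmoa_sup p f)"
  define s' where "s' = enn2real (bmoa_sup p (f \<circ> \<psi>))"
  define N where "N = bmoa_norm p f"
  have fh: "f holomorphic_on unit_disc" and fin: "bmoa_sup p f < \<infinity>"
    using f by (auto simp: BMOA_def)
  have \<psi>0: "norm (\<psi> 0) < 1"
    using sub by (simp add: image_subset_iff)
  have L: "0 \<le> L"
    unfolding L_def using \<psi>0 by (intro ln_ge_zero) (simp add: field_simps)
  have s: "bmoa_sup p f = ennreal s" "0 \<le> s"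
    using fin by (auto simp: s_def)
  have "s' \<le> 2000000 * s"
  proof -
    have "bmoa_sup p (f \<circ> \<psi>) \<le> ennreal (2000000 * s)"
      using bmoa_sup_comp_le[OF assms] s by (simp add: ennreal_mult)
    then show ?thesis
      unfolding s'_def using s by (intro enn2real_leI) auto
  qed
  have s'0: "0 \<le> s'" by (simp add: s'_def)
  have Nf: "norm (f 0) \<le> N"
  proof -
    have "norm (f 0) = (norm (f 0) powr p) powr (1 / p)"
      using p by (simp add: powr_powr)
    also have "\<dots> \<le> N"
      unfolding N_def bmoa_norm_def using p by (intro powr_mono2) auto
    finally show ?thesis .
  qed
  have Ns: "s powr (1 / p) \<le> N"
    unfolding N_def bmoa_norm_def s_def using p by (intro powr_mono2) auto
  have "s' powr (1 / p) \<le> (2000000 * s) powr (1 / p)"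
    using \<open>s' \<le> 2000000 * s\<close> s'0 p by (intro powr_mono2) auto
  also have "\<dots> = 2000000 powr (1 / p) * s powr (1 / p)"
    by (simp add: powr_mult)
  also have "\<dots> \<le> 2000000 powr 1 * N"
    using Ns p by (intro mult_mono powr_mono) auto
  finally have s'N: "s' powr (1 / p) \<le> 2000000 * N"
    by simp
  have "norm (f (\<psi> 0) - f 0) \<le> (20 * s powr (1 / p)) / 2 * L"
    unfolding L_def s_def using norm_deriv_le_bmoa_sup[OF f _ p] by (intro Bloch_growth fh \<psi>0) auto
  also have "\<dots> \<le> (20 * N) / 2 * L"
    using Ns L by (intro mult_right_mono) auto
  finally have "norm (f (\<psi> 0)) \<le> N + 10 * N * L"
    using Nf norm_triangle_ineq2[of "f (\<psi> 0)" "f 0"] by simp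
  moreover have "bmoa_norm p (f \<circ> \<psi>) \<le> norm (f (\<psi> 0)) + s' powr (1 / p)"
    unfolding bmoa_norm_def s'_def comp_apply using p by (intro powr_root_add_le) auto
  ultimately have "bmoa_norm p (f \<circ> \<psi>) \<le> N + 10 * N * L + 2000000 * N"
    using s'N by linarith
  also have "\<dots> \<le> 3000000 * (1 + L) * N"
  proof -
    have N: "0 \<le> N"
      using Nf norm_ge_zero[of "f 0"] by linarith
    then have "0 \<le> N * L"
      using L by simp
    moreover have "3000000 * (1 + L) * N = 3000000 * N + 3000000 * (N * L)"
      by (simp add: algebra_simps)
    moreover have "10 * N * L = 10 * (N * L)"
      by simp
    ultimately show ?thesis using N by linarith
  qed
  finally show ?thesis
    by (simp add: L_def N_def)
qed

theorem theorem1: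
  fixes p :: real
  assumes "1 \<le> p" and "p < 2"
  shows "\<exists>C::real. C > 0 \<and>
    (\<forall>\<psi> :: complex \<Rightarrow> complex.
       \<psi> holomorphic_on unit_disc \<and> \<psi> ` unit_disc \<subseteq> unit_disc \<and> inj_on \<psi> unit_disc \<longrightarrow>
         bounded_operator (BMOA p) (BMOA p) (bmoa_norm p) (composition_operator \<psi>) \<and>
         operator_norm (BMOA p) (bmoa_norm p) (composition_operator \<psi>)
           \<le> ennreal (C * (1 + ln ((1 + norm (\<psi> 0)) / (1 - norm (\<psi> 0))))) \<and>
         bounded_operator (VMOA p) (VMOA p) (bmoa_norm p) (composition_operator \<psi>))"
proof (intro exI[of _ "3000000::real"] conjI allI impI)
  note p = assms
  fix \<psi> :: "complex \<Rightarrow> complex"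
  assume "\<psi> holomorphic_on unit_disc \<and> \<psi> ` unit_disc \<subseteq> unit_disc \<and> inj_on \<psi> unit_disc"
  then have hol: "\<psi> holomorphic_on unit_disc" and sub: "\<psi> ` unit_disc \<subseteq> unit_disc" and inj: "inj_on \<psi> unit_disc"
    by auto
  define K where "K = 3000000 * (1 + ln ((1 + norm (\<psi> 0)) / (1 - norm (\<psi> 0))))"
  have bound: "bmoa_norm p (composition_operator \<psi> f) \<le> K * bmoa_norm p f" if "f \<in> BMOA p" for f
    unfolding composition_operator_def K_def by (rule bmoa_norm_comp_le[OF that hol sub inj p])
  have VB: "f \<in> BMOA p" if "f \<in> VMOA p" for f
    using that by (simp add: VMOA_def)
  have "norm (\<psi> 0) < 1"
    using sub by (simp add: image_subset_iff)
  then have "0 \<le> ln ((1 + norm (\<psi> 0)) / (1 - norm (\<psi> 0)))"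
    by (intro ln_ge_zero) (simp add: field_simps)
  then have K: "0 \<le> K"
    by (simp add: K_def)
  show "bounded_operator (BMOA p) (BMOA p) (bmoa_norm p) (composition_operator \<psi>)"
    unfolding bounded_operator_def
    using bound BMOA_comp[OF _ hol sub inj p] by (auto simp: composition_operator_def fun_eq_iff)
  \<comment> \<open>The norm is the same on the subspace, so the inequality is inherited with the
    same \<open>K\<close>; what is new is that the image function again satisfies the boundary
    limit.\<close>
  show "bounded_operator (VMOA p) (VMOA p) (bmoa_norm p) (composition_operator \<psi>)"
    unfolding bounded_operator_def
  proof (intro conjI ballI allI exI[of _ K])
    fix f assume f: "f \<in> VMOA p"
    show "composition_operator \<psi> f \<in> VMOA p"
      using BMOA_comp[OF VB[OF f] hol sub inj p] VMOA_comp_tendsto[OF f hol sub inj p]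
      by (simp only: VMOA_def composition_operator_def mem_Collect_eq)
    show "bmoa_norm p (composition_operator \<psi> f) \<le> K * bmoa_norm p f"
      using bound[OF VB[OF f]] .
  qed (simp_all add: composition_operator_def fun_eq_iff)
  show "operator_norm (BMOA p) (bmoa_norm p) (composition_operator \<psi>)
      \<le> ennreal (3000000 * (1 + ln ((1 + norm (\<psi> 0)) / (1 - norm (\<psi> 0)))))"
    unfolding operator_norm_def K_def[symmetric]
  proof (rule SUP_least)
    fix f assume "f \<in> {f \<in> BMOA p. bmoa_norm p f \<le> 1}"
    then show "ennreal (bmoa_norm p (composition_operator \<psi> f)) \<le> ennreal K"
      using bound[of f] K mult_left_mono[of "bmoa_norm p f" 1 K] by (intro ennreal_leI) auto
  qed
qed simp

end
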